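(* Let $M$ be a plane perfect matching on $v_1,\dots,v_{2n}$ containing edges $v_iv_l$ and $v_jv_k$, where $1\le i<j<k<l\le 2n$, $j>i+2$, $k>j+2$, $l>k+2$, and suppose that this pair of edges is flippable. Let $M'$ be the matching obtained from $M$ by replacing $v_iv_l,v_jv_k$ by $v_iv_j,v_kv_l$ and keeping all other edges. Let $D(T_M)=(a_1,\dots,a_n)$ be the outdegree sequence of the triangulation $T_M$, and let $1\le p<q\le n$ be the indices such that $a_p$ is the number of consecutive 1s in $B(M)$ starting with $b_j=b_{j+1}=1$ up to the next 0, and $a_{q+1}$ is the number of consecutive 1s in $B(M)$ starting with $b_{k+1}=1$ up to the next 0 (so that $a_q$ is the number of 1s between $b_{k-1}=0$ and $b_k=0$, i.e. $a_q=0$). Thus $$D(T_M)=(a_1,\dots,a_{p-1},a_p,a_{p+1},\dots,a_{q-1},0,a_{q+1},a_{q+2},\dots,a_n).$$ Then $D(T_{M'})=(d_1,\dots,d_n)$ is given by $$d_r=a_r\ (1\le r\le p-1),\quad d_p=0,\quad d_{p+1}=a_p-1,\quad d_{r+1}=a_r\ (p+1\le r\le q-1),\quad d_{q+1}=a_{q+1}+1,\quad d_r=a_r\ (q+2\le r\le n).$$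
   Context: Matchings: plane (non-crossing) perfect matchings on vertices $v_1,\dots,v_{2n}$ lying in this cyclic order on a circle. Each edge $v_av_b$ with $a<b$ is directed from $v_a$ to $v_b$. $B(M)=(b_1,\dots,b_{2n})$ is the sequence of outdegrees (a 0/1-sequence), and it determines $M$. The edges of $M$ partition the disk bounded by the circle into inner faces. A pair of edges $v_iv_l,v_jv_k$ ($i<j<k<l$) of $M$ is flippable if the four vertices $v_i,v_j,v_k,v_l$ are incident to a common inner face. Replacing these edges by $v_iv_j,v_kv_l$ is called a matching-flip, and the result is again a plane perfect matching. Triangulations: triangulations of a convex $(n+2)$-gon with points $p_1,\dots,p_{n+2}$ in clockwise order, with edges directed from lower to higher index. $D(T)=(d_1,\dots,d_n)$, where $d_i$ is the outdegree of $p_i$ counting all diagonals and the boundary edge $p_1p_{n+2}$, but no other boundary edge; $D(T)$ determines $T$. Bijection: $T_M$ is the triangulation for which $d_1$ is the number of 1s before the first 0 in $B(M)$ and, for $2\le i\le n$, $d_i$ is the number of 1s between the $(i-1)$-st 0 and the $i$-th 0 of $B(M)$. The map $M\mapsto T_M$ is a bijection between plane perfect matchings on $v_1,\dots,v_{2n}$ and triangulations of the convex $(n+2)$-gon. *)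

theory Defs
  imports "HOL-Analysis.Analysis"
begin

text \<open>
  Points are complex numbers, and a family of \<open>N\<close> points is a function on the indices \<open>1, ..., N\<close>.
  An edge is a pair \<open>(a, b)\<close> of indices with \<open>a < b\<close>, which stands for the straight segment
  directed from point \<open>a\<close> to point \<open>b\<close>.
\<close>

type_synonym edge = "nat \<times> nat"

text \<open>Twice the signed area of the triangle \<open>a b c\<close>; it is negative iff \<open>a, b, c\<close> make a
  clockwise turn.\<close>

definition orient :: "complex \<Rightarrow> complex \<Rightarrow> complex \<Rightarrow> real" where
  "orient a b c = Im (cnj (b - a) * (c - a))"

definition clockwise :: "nat \<Rightarrow> (nat \<Rightarrow> complex) \<Rightarrow> bool" where
  "clockwise N x \<longleftrightarrow>
     (\<forall>a b c. 1 \<le> a \<and> a < b \<and> b < c \<and> c \<le> N \<longrightarrow> orient (x a) (x b) (x c) < 0)"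

definition counterclockwise :: "nat \<Rightarrow> (nat \<Rightarrow> complex) \<Rightarrow> bool" where
  "counterclockwise N x \<longleftrightarrow>
     (\<forall>a b c. 1 \<le> a \<and> a < b \<and> b < c \<and> c \<le> N \<longrightarrow> orient (x a) (x b) (x c) > 0)"

definition cyclic_on_circle ::
    "complex \<Rightarrow> real \<Rightarrow> nat \<Rightarrow> (nat \<Rightarrow> complex) \<Rightarrow> bool" where
  "cyclic_on_circle z r N v \<longleftrightarrow>
     0 < r \<and> inj_on v {1..N} \<and> v ` {1..N} \<subseteq> sphere z r \<and>
     (clockwise N v \<or> counterclockwise N v)"

definition edges_on :: "nat \<Rightarrow> edge set" where
  "edges_on N = {(a, b). 1 \<le> a \<and> a < b \<and> b \<le> N}"

definition seg :: "(nat \<Rightarrow> complex) \<Rightarrow> edge \<Rightarrow> complex set" where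
  "seg x e = open_segment (x (fst e)) (x (snd e))"

definition noncrossing :: "(nat \<Rightarrow> complex) \<Rightarrow> edge \<Rightarrow> edge \<Rightarrow> bool" where
  "noncrossing x e f \<longleftrightarrow> disjnt (seg x e) (seg x f)"

definition plane_perfect_matching :: "nat \<Rightarrow> (nat \<Rightarrow> complex) \<Rightarrow> edge set \<Rightarrow> bool" where
  "plane_perfect_matching n v M \<longleftrightarrow>
     M \<subseteq> edges_on (2 * n) \<and>
     (\<forall>x\<in>{1..2 * n}. \<exists>!e. e \<in> M \<and> (x = fst e \<or> x = snd e)) \<and>
     pairwise (noncrossing v) M"

definition outdeg :: "edge set \<Rightarrow> nat \<Rightarrow> nat" where
  "outdeg E a = card {b. (a, b) \<in> E}"

definition inner_faces ::
    "complex \<Rightarrow> real \<Rightarrow> (nat \<Rightarrow> complex) \<Rightarrow> edge set \<Rightarrow> complex set set" where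
  "inner_faces z r v M = components (ball z r - (\<Union>e\<in>M. seg v e))"

text \<open>Faces are open, so a vertex is incident to a face iff it lies in its closure.\<close>

definition flippable ::
    "complex \<Rightarrow> real \<Rightarrow> (nat \<Rightarrow> complex) \<Rightarrow> edge set \<Rightarrow> edge \<Rightarrow> edge \<Rightarrow> bool" where
  "flippable z r v M e f \<longleftrightarrow>
     e \<in> M \<and> f \<in> M \<and> fst e < fst f \<and> fst f < snd f \<and> snd f < snd e \<and>
     (\<exists>F\<in>inner_faces z r v M. {v (fst e), v (fst f), v (snd f), v (snd e)} \<subseteq> closure F)"

definition matching_flip :: "edge set \<Rightarrow> edge \<Rightarrow> edge \<Rightarrow> edge set" where
  "matching_flip M e f = M - {e, f} \<union> {(fst e, fst f), (snd f, snd e)}"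

text \<open>A triangulation of a convex polygon, given by its set of edges, boundary edges included: a
  maximal set of pairwise non-crossing segments between the corners.\<close>

definition polygon_triangulation :: "nat \<Rightarrow> (nat \<Rightarrow> complex) \<Rightarrow> edge set \<Rightarrow> bool" where
  "polygon_triangulation N x T \<longleftrightarrow>
     T \<subseteq> edges_on N \<and> pairwise (noncrossing x) T \<and>
     (\<forall>e\<in>edges_on N. (\<forall>f\<in>T. f \<noteq> e \<longrightarrow> noncrossing x e f) \<longrightarrow> e \<in> T)"

text \<open>The degrees \<open>d\<^sub>i\<close>: all boundary edges except the one from \<open>1\<close> to \<open>N\<close> have the form
  \<open>(i, i + 1)\<close>, and these are not counted.\<close>

definition tri_outdeg :: "edge set \<Rightarrow> nat \<Rightarrow> nat" where
  "tri_outdeg T i = card {b. (i, b) \<in> T \<and> b \<noteq> i + 1}"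

definition nth_zero :: "nat \<Rightarrow> edge set \<Rightarrow> nat \<Rightarrow> nat" where
  "nth_zero n M i = sorted_list_of_set {x \<in> {1..2 * n}. outdeg M x = 0} ! (i - 1)"

text \<open>Positions of the 1s before the first 0 (for \<open>i = 1\<close>), or between the \<open>(i - 1)\<close>-st and the
  \<open>i\<close>-th 0 (for \<open>2 \<le> i \<le> n\<close>).\<close>

definition ones_block :: "nat \<Rightarrow> edge set \<Rightarrow> nat \<Rightarrow> nat set" where
  "ones_block n M i =
     {x \<in> {1..2 * n}. outdeg M x = 1 \<and> (2 \<le> i \<longrightarrow> nth_zero n M (i - 1) < x) \<and> x < nth_zero n M i}"

text \<open>Positions of the consecutive 1s starting at position \<open>s\<close> up to the next 0.\<close>

definition ones_run :: "nat \<Rightarrow> edge set \<Rightarrow> nat \<Rightarrow> nat set" where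
  "ones_run n M s = {x \<in> {s..2 * n}. \<forall>y\<in>{s..x}. outdeg M y = 1}"

definition triangulation_of :: "nat \<Rightarrow> (nat \<Rightarrow> complex) \<Rightarrow> edge set \<Rightarrow> edge set" where
  "triangulation_of n x M =
     (THE T. polygon_triangulation (n + 2) x T \<and>
             (\<forall>i\<in>{1..n}. tri_outdeg T i = card (ones_block n M i)))"

text \<open>The indices \<open>p\<close> and \<open>q\<close> for which \<open>a\<^sub>p\<close> and \<open>a\<^bsub>q+1\<^esub>\<close> count the runs of 1s that start at
  \<open>j\<close> and at \<open>k + 1\<close>. A block is identified by its positions, as its length alone would not
  determine it; \<open>q + 1 \<le> n\<close> because \<open>a\<^bsub>q+1\<^esub>\<close> is an entry of the sequence.\<close>

definition run_indices :: "nat \<Rightarrow> edge set \<Rightarrow> nat \<Rightarrow> nat \<Rightarrow> nat \<Rightarrow> nat \<Rightarrow> bool" where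
  "run_indices n M j k p q \<longleftrightarrow>
     1 \<le> p \<and> p < q \<and> q + 1 \<le> n \<and>
     ones_block n M p = ones_run n M j \<and> ones_block n M (q + 1) = ones_run n M (k + 1)"

end

theory Submission
  imports Defs
begin

text \<open>Replacing \<open>v\<^sub>iv\<^sub>l, v\<^sub>jv\<^sub>k\<close> by \<open>v\<^sub>iv\<^sub>j, v\<^sub>kv\<^sub>l\<close> only turns the 1 at position \<open>j\<close> of \<open>B(M)\<close> into a 0 and
  the 0 at position \<open>k\<close> into a 1. An edge joining a vertex strictly between \<open>i\<close> and \<open>j\<close> to one strictly
  between \<open>k\<close> and \<open>l\<close> would separate the pair, so flippability forces \<open>b\<^bsub>j-1\<^esub> = 0\<close> and
  \<open>b\<^bsub>k+1\<^esub> = 1\<close>, and planarity gives \<open>b\<^bsub>j+1\<^esub> = 1\<close> and \<open>b\<^bsub>k-1\<^esub> = 0\<close>. Hence the blocks of 1s change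
  exactly as claimed. It remains to see that the block lengths of a ballot word are the outdegrees
  of a unique triangulation, which is read off the lattice path of the word.\<close>

subsection \<open>Segments between points in convex position\<close>

lemma orient_expand:
  "orient a b c = (Re b - Re a) * (Im c - Im a) - (Im b - Im a) * (Re c - Re a)"
  by (simp add: orient_def algebra_simps)

lemma orient_rotate: "orient a b c = orient b c a"
  by (simp add: orient_expand algebra_simps)

lemma orient_swap: "orient a b c = - orient a c b"
  by (simp add: orient_expand algebra_simps)

lemma orient_refl [simp]: "orient a b a = 0" "orient a b b = 0"
  by (simp_all add: orient_expand)

lemma orient_affine:
  "orient a b ((1 - u) *\<^sub>R c + u *\<^sub>R d) = (1 - u) * orient a b c + u * orient a b d"
  by (simp add: orient_expand algebra_simps)

text \<open>Cramer's rule gives the common point of the two lines: \<open>u\<close> and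
  \<open>w\<close> are its parameters along \<open>a b\<close> and \<open>c d\<close>, and the sign
  conditions put both strictly between 0 and 1.\<close>

lemma open_segments_cross:
  assumes "orient a b c * orient a b d < 0" "orient c d a * orient c d b < 0"
  shows "\<not> disjnt (open_segment a b) (open_segment c d)"
proof -
  define D where "D = orient c d a - orient c d b"
  define u where "u = orient c d a / D"
  define w where "w = - orient a b c / D"
  have D': "orient a b c - orient a b d = - D"
    by (simp add: D_def orient_expand algebra_simps)
  have D: "D \<noteq> 0" using assms(2) by (auto simp: D_def mult_less_0_iff)
  have u: "0 < u" "u < 1"
    using assms(2) by (auto simp: u_def D_def mult_less_0_iff field_simps)
  have w: "0 < w" "w < 1"
    using assms(1) D' by (auto simp: w_def mult_less_0_iff field_simps)
  \<comment> \<open>Multiplying by \<open>D\<close> clears the denominators of \<open>u\<close> and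
    \<open>w\<close>, which leaves polynomial identities in the coordinates.\<close>
  have "D * ((1 - u) * Re a + u * Re b) = D * ((1 - w) * Re c + w * Re d)"
       "D * ((1 - u) * Im a + u * Im b) = D * ((1 - w) * Im c + w * Im d)"
    using D by (simp_all add: u_def w_def algebra_simps, simp_all add: D_def orient_expand algebra_simps)
  then have "(1 - u) *\<^sub>R a + u *\<^sub>R b = (1 - w) *\<^sub>R c + w *\<^sub>R d"
    using D by (simp add: complex_eq_iff)
  moreover have "a \<noteq> b" "c \<noteq> d"
    using assms by (auto simp: orient_expand)
  ultimately show ?thesis
    using u w by (auto simp: disjnt_iff in_segment)
qed

text \<open>One-sided on purpose: \<open>e\<close> is the edge that starts first. For an unordered
  pair both \<open>crossing e f\<close> and \<open>crossing f e\<close> have to be excluded.\<close>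

definition crossing :: "edge \<Rightarrow> edge \<Rightarrow> bool" where
  "crossing e f \<longleftrightarrow> fst e < fst f \<and> fst f < snd e \<and> snd e < snd f"

lemma clockwiseD:
  "\<lbrakk>clockwise N x; 1 \<le> a; a < b; b < c; c \<le> N\<rbrakk> \<Longrightarrow> orient (x a) (x b) (x c) < 0"
  by (auto simp: clockwise_def)

lemma clockwise_orient_outer:
  assumes "clockwise N x" "1 \<le> a" "a < b" "b \<le> N" "1 \<le> c" "c \<le> N" "c < a \<or> b < c"
  shows "orient (x a) (x b) (x c) < 0"
  using assms clockwiseD[of N x a b c] clockwiseD[of N x c a b] orient_rotate[of "x c"] by auto

lemma clockwise_orient_inner:
  assumes "clockwise N x" "1 \<le> a" "a < c" "c < b" "b \<le> N"
  shows "0 < orient (x a) (x b) (x c)"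
  using clockwiseD[of N x a c b] orient_swap[of "x a" "x c" "x b"] assms by auto

lemma orient_cnj: "orient (cnj a) (cnj b) (cnj c) = - orient a b c"
  by (simp add: orient_expand algebra_simps)

lemma counterclockwise_cnj: "counterclockwise N x \<longleftrightarrow> clockwise N (cnj \<circ> x)"
  by (simp add: clockwise_def counterclockwise_def orient_cnj)

text \<open>The product states the separation by the chord without reference to the orientation of
  the cycle; complex conjugation reduces the counterclockwise case to the clockwise one.\<close>

lemma cyclic_orient_opposite:
  assumes "clockwise N x \<or> counterclockwise N x"
    and "1 \<le> a" "a < b" "b \<le> N" "1 \<le> c" "c \<le> N" "c < a \<or> b < c" "a < d" "d < b"
  shows "orient (x a) (x b) (x c) * orient (x a) (x b) (x d) < 0"
  using assms(1)
proof
  assume "clockwise N x"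
  then show ?thesis
    using clockwise_orient_outer[of N x a b c] clockwise_orient_inner[of N x a d b] assms(2-)
    by (simp add: mult_neg_pos)
next
  assume "counterclockwise N x"
  then have "clockwise N (cnj \<circ> x)" by (simp add: counterclockwise_cnj)
  then show ?thesis
    using clockwise_orient_outer[of N "cnj \<circ> x" a b c] clockwise_orient_inner[of N "cnj \<circ> x" a d b] assms(2-)
    by (simp add: orient_cnj mult_pos_neg)
qed

lemma crossing_not_noncrossing:
  assumes "clockwise N x \<or> counterclockwise N x" "e \<in> edges_on N" "f \<in> edges_on N" "crossing e f"
  shows "\<not> noncrossing x e f"
proof -
  obtain a b c d where ef: "e = (a, b)" "f = (c, d)" by fastforce
  have ord: "1 \<le> a" "a < c" "c < b" "b < d" "d \<le> N"
    using assms(2-4) by (auto simp: ef edges_on_def crossing_def)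
  have "orient (x a) (x b) (x d) * orient (x a) (x b) (x c) < 0"
    using cyclic_orient_opposite[OF assms(1), of a b d c] ord by simp
  moreover have "orient (x c) (x d) (x a) * orient (x c) (x d) (x b) < 0"
    using cyclic_orient_opposite[OF assms(1), of c d a b] ord by simp
  ultimately show ?thesis
    unfolding noncrossing_def seg_def ef fst_conv snd_conv
    by (intro open_segments_cross) (simp_all add: mult.commute)
qed

text \<open>If the indices do not interleave, \<open>x c\<close> and \<open>x d\<close> lie on one
  closed side of the line through \<open>x a\<close> and \<open>x b\<close>, and not both on the
  line. The side function \<open>g\<close> is affine, so it has no zero inside the segment from
  \<open>x c\<close> to \<open>x d\<close>.\<close>

lemma clockwise_noncrossing:
  assumes cw: "clockwise N x" and e: "e \<in> edges_on N" and f: "f \<in> edges_on N" and "e \<noteq> f"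
    and nc: "\<not> crossing e f" "\<not> crossing f e"
  shows "noncrossing x e f"
proof -
  obtain a b c d where ef: "e = (a, b)" "f = (c, d)" by fastforce
  define g where "g y = orient (x a) (x b) (x y)" for y
  have ab: "1 \<le> a" "a < b" "b \<le> N" "1 \<le> c" "c < d" "d \<le> N"
    using e f by (auto simp: ef edges_on_def)
  have out: "g y < 0" if "1 \<le> y" "y \<le> N" "y < a \<or> b < y" for y
    using clockwise_orient_outer[OF cw] ab that by (auto simp: g_def)
  have inn: "g y > 0" if "a < y" "y < b" for y
    using clockwise_orient_inner[OF cw] ab that by (auto simp: g_def)
  have zero: "g a = 0" "g b = 0" by (simp_all add: g_def)
  have sides: "(g c \<le> 0 \<and> g d \<le> 0 \<or> g c \<ge> 0 \<and> g d \<ge> 0) \<and> (g c \<noteq> 0 \<or> g d \<noteq> 0)"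
  proof (cases "a \<le> c \<and> d \<le> b")
    case True
    have "g c \<ge> 0" "g d \<ge> 0"
      using True ab inn[of c] inn[of d] zero
      by (metis less_eq_real_def order_less_le le_less_trans less_le_trans)+
    moreover have "c \<noteq> a \<or> d \<noteq> b" using \<open>e \<noteq> f\<close> ef by auto
    then have "g c \<noteq> 0 \<or> g d \<noteq> 0"
      using True ab inn[of c] inn[of d]
      by (metis less_irrefl order_less_le le_less_trans less_le_trans)
    ultimately show ?thesis by blast
  next
    case False
    have c: "c \<le> a \<or> b \<le> c" and d: "d \<le> a \<or> b \<le> d"
      using nc False ab by (auto simp: ef crossing_def)
    have "g c \<le> 0"
      using c ab out[of c] zero by (cases "c = a \<or> c = b") force+
    moreover have "g d \<le> 0"
      using d ab out[of d] zero by (cases "d = a \<or> d = b") force+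
    moreover have "g c < 0 \<or> g d < 0"
      using c d False ab out[of c] out[of d] by force
    ultimately show ?thesis by auto
  qed
  show ?thesis
    unfolding noncrossing_def disjnt_iff seg_def ef fst_conv snd_conv
  proof (intro allI notI, elim conjE)
    fix y assume "y \<in> open_segment (x a) (x b)" "y \<in> open_segment (x c) (x d)"
    then obtain s u where s: "y = (1 - s) *\<^sub>R x a + s *\<^sub>R x b"
      and u: "0 < u" "u < 1" "y = (1 - u) *\<^sub>R x c + u *\<^sub>R x d"
      unfolding in_segment by metis
    have "orient (x a) (x b) y = 0" by (simp only: s orient_affine) simp
    then have 0: "(1 - u) * g c + u * g d = 0"
      by (simp only: u(3) orient_affine g_def)
    have "(1 - u) * g c + u * g d \<noteq> 0"
    proof (cases "g c \<le> 0 \<and> g d \<le> 0")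
      case True
      then have "(1 - u) * g c \<le> 0" "u * g d \<le> 0" "(1 - u) * g c < 0 \<or> u * g d < 0"
        using u sides by (auto simp: mult_le_0_iff mult_less_0_iff)
      then show ?thesis by linarith
    next
      case False
      then have "(1 - u) * g c \<ge> 0" "u * g d \<ge> 0" "(1 - u) * g c > 0 \<or> u * g d > 0"
        using u sides by (auto simp: zero_less_mult_iff)
      then show ?thesis by linarith
    qed
    with 0 show False by blast
  qed
qed

lemma noncrossing_sym: "noncrossing x e f \<Longrightarrow> noncrossing x f e"
  by (simp add: noncrossing_def disjnt_sym)

lemma clockwise_noncrossing_iff:
  assumes "clockwise N x" "e \<in> edges_on N" "f \<in> edges_on N" "e \<noteq> f"
  shows "noncrossing x e f \<longleftrightarrow> \<not> crossing e f \<and> \<not> crossing f e"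
  using clockwise_noncrossing[OF assms] crossing_not_noncrossing[of N x e f]
    crossing_not_noncrossing[of N x f e] noncrossing_sym assms by blast

text \<open>This removes the geometry: from here on a triangulation is a maximal set of index pairs
  no two of which interleave.\<close>

lemma polygon_triangulation_iff:
  assumes "clockwise N x"
  shows "polygon_triangulation N x T \<longleftrightarrow>
    T \<subseteq> edges_on N \<and> (\<forall>e\<in>T. \<forall>f\<in>T. \<not> crossing e f) \<and>
    (\<forall>e\<in>edges_on N. (\<forall>f\<in>T. \<not> crossing e f \<and> \<not> crossing f e) \<longrightarrow> e \<in> T)"
proof (cases "T \<subseteq> edges_on N")
  case True
  have irrefl: "\<not> crossing e e" for e by (simp add: crossing_def)
  have "pairwise (noncrossing x) T \<longleftrightarrow> (\<forall>e\<in>T. \<forall>f\<in>T. \<not> crossing e f)"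
    using True clockwise_noncrossing_iff[OF assms] irrefl unfolding pairwise_def by (metis subsetD)
  moreover have "(\<forall>f\<in>T. f \<noteq> e \<longrightarrow> noncrossing x e f) \<longleftrightarrow>
      (\<forall>f\<in>T. \<not> crossing e f \<and> \<not> crossing f e)" if "e \<in> edges_on N" for e
    using True clockwise_noncrossing_iff[OF assms that] irrefl by (metis subsetD)
  ultimately show ?thesis
    by (simp add: polygon_triangulation_def)
qed (simp add: polygon_triangulation_def)

subsection \<open>Triangulations from ballot paths\<close>

text \<open>A discrete intermediate value theorem: the first time at or below level \<open>h\<close>
  is a time exactly at \<open>h\<close>.\<close>

lemma first_passage:
  fixes H :: "nat \<Rightarrow> int"
  assumes step: "\<And>m. \<lbrakk>i \<le> m; m < N\<rbrakk> \<Longrightarrow> H m - 1 \<le> H (Suc m)"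
    and "i \<le> N" "h \<le> H i" "H N \<le> h"
  obtains m where "i \<le> m" "m \<le> N" "H m = h" "\<And>t. \<lbrakk>i \<le> t; t < m\<rbrakk> \<Longrightarrow> h < H t"
proof -
  define m where "m = (LEAST m. i \<le> m \<and> H m \<le> h)"
  have ex: "i \<le> N \<and> H N \<le> h" using assms by blast
  have m: "i \<le> m" "H m \<le> h"
    using LeastI[of "\<lambda>m. i \<le> m \<and> H m \<le> h", OF ex] by (auto simp: m_def)
  have mN: "m \<le> N" using Least_le[of "\<lambda>m. i \<le> m \<and> H m \<le> h", OF ex] by (simp add: m_def)
  have below: "h < H t" if "i \<le> t" "t < m" for t
    using not_less_Least[of t "\<lambda>m. i \<le> m \<and> H m \<le> h"] that by (auto simp: m_def)
  have "h \<le> H m"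
  \<comment> \<open>Just before \<open>m\<close> the height is at least \<open>h + 1\<close>, and a
    single step descends by at most 1.\<close>
  proof (cases "m = i")
    case False
    then have "i \<le> m - 1" "m - 1 < m" using m by auto
    then show ?thesis using below[of "m - 1"] step[of "m - 1"] mN by auto
  qed (use assms in simp)
  then show ?thesis using that m mN below by force
qed

text \<open>A down step of the path at time \<open>m\<close> belongs to the corner \<open>m + 1\<close>. The corners joined to a
  lower corner \<open>i\<close> are those at which the path, from time \<open>i\<close> on, attains a new minimum, as long as
  it stays at height at least \<open>H (i - 1) - 1\<close>. A last step to height \<open>-1\<close> is appended for the
  corner \<open>n + 2\<close>.\<close>

definition path_edges :: "nat \<Rightarrow> (nat \<Rightarrow> int) \<Rightarrow> edge set" where
  "path_edges n H = {(i, k). 1 \<le> i \<and> i < k \<and> k \<le> n + 2 \<and> H (i - 1) - 1 \<le> H (k - 1) \<and>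
     (\<forall>t. i \<le> t \<and> t < k - 1 \<longrightarrow> H (k - 1) < H t)}"

text \<open>The intended height is \<open>H m\<close> = d_1 + ... + d_m - m, so \<open>step\<close>
  expresses nonnegative degrees and \<open>nonneg\<close> the ballot condition. Together with
  \<open>step\<close> and \<open>nonneg\<close> at \<open>n\<close>, \<open>final\<close> forces
  \<open>H n = 0\<close>.\<close>

locale ballot_path =
  fixes n :: nat and H :: "nat \<Rightarrow> int"
  assumes start: "H 0 = 0"
    and nonneg: "m \<le> n \<Longrightarrow> 0 \<le> H m"
    and final: "H (Suc n) = - 1"
    and step: "m \<le> n \<Longrightarrow> H m - 1 \<le> H (Suc m)"
begin

text \<open>For i < i' < k < k' the heights at times i' - 1, k - 1, k' - 1 would decrease strictly,
  a drop of at least 2, whereas the edge from i' allows a drop of at most 1.\<close>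

lemma path_edges_not_crossing:
  assumes "e \<in> path_edges n H" "f \<in> path_edges n H"
  shows "\<not> crossing e f"
proof
  assume cr: "crossing e f"
  obtain i k i' k' where ef: "e = (i, k)" "f = (i', k')" by fastforce
  have ord: "1 \<le> i" "i < i'" "i' < k" "k < k'"
    using assms cr by (auto simp: path_edges_def crossing_def ef)
  have "i' \<le> k - 1" "k - 1 < k' - 1" using ord by auto
  then have "H (k' - 1) < H (k - 1)" "H (i' - 1) - 1 \<le> H (k' - 1)"
    using assms by (auto simp: path_edges_def ef)
  moreover have "H (k - 1) < H (i' - 1)"
  proof -
    have "i \<le> i' - 1" "i' - 1 < k - 1" using ord by auto
    then show ?thesis using assms by (auto simp: path_edges_def ef)
  qed
  ultimately show False by linarith
qed

text \<open>A pair fails to be a path edge for one of two reasons: time \<open>k - 1\<close> is no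
  new strict minimum, or the path has gone too low by then. Each failure yields a crossing path
  edge.\<close>

lemma path_edges_maximal:
  assumes "(i, k) \<in> edges_on (n + 2)" "(i, k) \<notin> path_edges n H"
  shows "\<exists>f\<in>path_edges n H. crossing (i, k) f \<or> crossing f (i, k)"
proof -
  have ik: "1 \<le> i" "i < k" "k \<le> n + 2" using assms by (auto simp: edges_on_def)
  define m where "m = k - 1"
  have m: "i \<le> m" "m \<le> n + 1" "k = Suc m" using ik by (auto simp: m_def)
  show ?thesis
  proof (cases "\<exists>t. i \<le> t \<and> t < m \<and> H t \<le> H m")
    case True
    then obtain t0 where t0: "i \<le> t0" "t0 < m" "H t0 \<le> H m" by blast
    \<comment> \<open>The crossing edge starts at corner \<open>Suc t\<close>, where
      \<open>t\<close> is a minimizer on \<open>{i..<m}\<close>. It ends where the path first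
      reaches \<open>H t - 1\<close>, which happens only after \<open>m\<close>.\<close>
    have "finite (H ` {i..<m})" "H ` {i..<m} \<noteq> {}" using t0 by auto
    then have "Min (H ` {i..<m}) \<in> H ` {i..<m}" by (rule Min_in)
    then obtain t where t: "i \<le> t" "t < m" "H t = Min (H ` {i..<m})" by auto
    have least: "H t \<le> H s" if "i \<le> s" "s \<le> m" for s
      using that t t0 by (cases "s = m") (force intro: order_trans[of _ "H t0"])+
    obtain m' where m': "Suc t \<le> m'" "m' \<le> Suc n" "H m' = H t - 1"
        "\<And>s. \<lbrakk>Suc t \<le> s; s < m'\<rbrakk> \<Longrightarrow> H t - 1 < H s"
    proof (rule first_passage[of "Suc t" "Suc n" H "H t - 1"])
      show "H s - 1 \<le> H (Suc s)" if "s < Suc n" for s using step that by simp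
      show "Suc t \<le> Suc n" "H t - 1 \<le> H (Suc t)" "H (Suc n) \<le> H t - 1"
        using step[of t] nonneg[of t] final t(2) m by simp_all
    qed blast
    have "m < m'"
      using least[of m'] m' t by (cases "m' \<le> m") auto
    moreover have "(Suc t, Suc m') \<in> path_edges n H"
      using m' by (auto simp: path_edges_def)
    ultimately show ?thesis
      using t m by (intro bexI[of _ "(Suc t, Suc m')"]) (auto simp: crossing_def)
  next
    case False
    then have above: "H m < H t" if "i \<le> t" "t < m" for t using that by force
    have low: "H m < H (i - 1) - 1"
      using assms(2) above ik by (auto simp: path_edges_def m)
    have "H i \<ge> H (i - 1) - 1" using step[of "i - 1"] ik by auto
    \<comment> \<open>Now \<open>m0\<close> is the first time at the lowest level allowed for
      \<open>i\<close>; the crossing edge will end at \<open>Suc m0\<close>, strictly between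
      \<open>i\<close> and \<open>k\<close>.\<close>
    then obtain m0 where m0: "i \<le> m0" "m0 \<le> m" "H m0 = H (i - 1) - 1"
        "\<And>t. \<lbrakk>i \<le> t; t < m0\<rbrakk> \<Longrightarrow> H (i - 1) - 1 < H t"
      using first_passage[of i m H "H (i - 1) - 1"] step low m by auto
    have "m0 \<noteq> m" using m0 low by auto
    have "- 1 \<le> H m" using nonneg[of m] final m by (cases "m = Suc n") auto
    then have pos: "0 < H (i - 1)" using low by linarith
    \<comment> \<open>The starting corner is \<open>Suc s\<close>, where \<open>s\<close> is the
      last time before \<open>i\<close> at which the path is below \<open>H (i - 1)\<close>. Time 0
      is a candidate because \<open>H (i - 1)\<close> is positive.\<close>
    define S where "S = {s. s < i \<and> H s < H (i - 1)}"
    have "0 \<in> S" using pos start ik by (simp add: S_def)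
    then have "finite S" "S \<noteq> {}" by (auto simp: S_def)
    define s where "s = Max S"
    have s: "s < i" "H s < H (i - 1)" using Max_in[OF \<open>finite S\<close> \<open>S \<noteq> {}\<close>] by (auto simp: S_def s_def)
    have s_max: "H (i - 1) \<le> H t" if "s < t" "t < i" for t
    proof (rule ccontr)
      assume "\<not> H (i - 1) \<le> H t"
      then have "t \<le> s" unfolding s_def using \<open>finite S\<close> that by (intro Max_ge) (auto simp: S_def)
      then show False using that by simp
    qed
    have "Suc s < i" using s by (cases "s = i - 1") auto
    moreover have "H (i - 1) - 1 < H t" if "Suc s \<le> t" "t < m0" for t
      using s_max[of t] m0(4)[of t] that by (cases "t < i") auto
    then have "(Suc s, Suc m0) \<in> path_edges n H"
      using s m0 m by (auto simp: path_edges_def)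
    ultimately show ?thesis
      using m0 m \<open>m0 \<noteq> m\<close> by (intro bexI[of _ "(Suc s, Suc m0)"]) (auto simp: crossing_def)
  qed
qed

lemma path_edges_triangulation:
  assumes "clockwise (n + 2) x"
  shows "polygon_triangulation (n + 2) x (path_edges n H)"
proof -
  have "path_edges n H \<subseteq> edges_on (n + 2)"
    by (auto simp: path_edges_def edges_on_def)
  then show ?thesis
    unfolding polygon_triangulation_iff[OF assms]
    using path_edges_not_crossing path_edges_maximal by fast
qed

text \<open>By first passage, the upper neighbours of \<open>i\<close> correspond one to one to the
  levels from \<open>H (i - 1) - 1\<close> to \<open>H i\<close>. That is one more than claimed, and
  the side to \<open>Suc i\<close> is not counted.\<close>

lemma tri_outdeg_path_edges:
  assumes "1 \<le> i" "i \<le> n"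
  shows "int (tri_outdeg (path_edges n H) i) = H i - H (i - 1) + 1"
proof -
  have down: "H (i - 1) - 1 \<le> H i" using step[of "i - 1"] assms by simp
  define R where "R = {k. (i, k) \<in> path_edges n H}"
  have R: "k \<in> R \<longleftrightarrow> i < k \<and> k \<le> n + 2 \<and> H (i - 1) - 1 \<le> H (k - 1) \<and>
      (\<forall>t. i \<le> t \<and> t < k - 1 \<longrightarrow> H (k - 1) < H t)" for k
    using assms by (auto simp: R_def path_edges_def)
  have dec: "H (k' - 1) < H (k - 1)" if "k \<in> R" "k' \<in> R" "k < k'" for k k'
  proof -
    have "i \<le> k - 1" "k - 1 < k' - 1" using that R by auto
    then show ?thesis using that R by blast
  qed
  have inj: "inj_on (\<lambda>k. H (k - 1)) R"
    by (rule inj_onI) (metis dec less_irrefl linorder_neqE_nat)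
  have "(\<lambda>k. H (k - 1)) ` R = {H (i - 1) - 1..H i}"
  proof (intro equalityI subsetI)
    fix h assume "h \<in> (\<lambda>k. H (k - 1)) ` R"
    then obtain k where k: "k \<in> R" "h = H (k - 1)" by blast
    have "H (k - 1) \<le> H i"
      using k R[of k] by (cases "i = k - 1") (auto intro: less_imp_le)
    then show "h \<in> {H (i - 1) - 1..H i}" using k R by auto
  next
    fix h assume h: "h \<in> {H (i - 1) - 1..H i}"
    have "0 \<le> H (i - 1)" using nonneg[of "i - 1"] assms by simp
    then obtain m where "i \<le> m" "m \<le> Suc n" "H m = h" "\<And>t. \<lbrakk>i \<le> t; t < m\<rbrakk> \<Longrightarrow> h < H t"
      using first_passage[of i "Suc n" H h] step final h assms by auto
    then have "Suc m \<in> R" "h = H (Suc m - 1)" using R h by auto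
    then show "h \<in> (\<lambda>k. H (k - 1)) ` R" by blast
  qed
  then have "card R = card {H (i - 1) - 1..H i}"
    using card_image[OF inj] by metis
  also have "int \<dots> = H i - H (i - 1) + 2"
    using down by simp
  finally have card: "int (card R) = H i - H (i - 1) + 2" .
  have "Suc i \<in> R" using down assms by (simp add: R)
  moreover have "finite R" by (rule finite_subset[of _ "{..n + 2}"]) (auto simp: R)
  ultimately have "Suc (card (R - {Suc i})) = card R" by (metis card_Suc_Diff1)
  moreover have "{b. (i, b) \<in> path_edges n H \<and> b \<noteq> i + 1} = R - {Suc i}"
    by (auto simp: R_def)
  ultimately have "Suc (tri_outdeg (path_edges n H) i) = card R"
    by (simp only: tri_outdeg_def)
  then show ?thesis using card by linarith
qed

end

section \<open>Outdegrees determine a triangulation\<close>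

lemma triangulation_boundary:
  assumes "clockwise N x" "polygon_triangulation N x T" "1 \<le> i" "Suc i \<le> N"
  shows "(i, Suc i) \<in> T"
proof -
  have "(i, Suc i) \<in> edges_on N" using assms by (simp add: edges_on_def)
  moreover have "\<not> crossing (i, Suc i) f" "\<not> crossing f (i, Suc i)" for f
    by (auto simp: crossing_def)
  ultimately show ?thesis
    using assms(2) unfolding polygon_triangulation_iff[OF assms(1)] by blast
qed

text \<open>Consecutive neighbours \<open>k\<close>, \<open>k'\<close> of \<open>i\<close> span a
  triangle: an edge crossing \<open>(k, k')\<close> would cross \<open>(i, k)\<close> or
  \<open>(i, k')\<close>, or join \<open>i\<close> to a corner between them. A longer edge from
  \<open>k\<close> would cross \<open>(i, k')\<close>.\<close>

lemma triangulation_consecutive: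
  assumes cw: "clockwise N x" and T: "polygon_triangulation N x T"
    and k: "(i, k) \<in> T" "(i, k') \<in> T" "k < k'"
    and consecutive: "\<And>y. \<lbrakk>k < y; y < k'\<rbrakk> \<Longrightarrow> (i, y) \<notin> T"
  shows "(k, k') \<in> T" "\<And>y. (k, y) \<in> T \<Longrightarrow> y \<le> k'"
proof -
  have sub: "T \<subseteq> edges_on N" and nc: "\<And>e f. \<lbrakk>e \<in> T; f \<in> T\<rbrakk> \<Longrightarrow> \<not> crossing e f"
    and max: "\<And>e. \<lbrakk>e \<in> edges_on N; \<forall>f\<in>T. \<not> crossing e f \<and> \<not> crossing f e\<rbrakk> \<Longrightarrow> e \<in> T"
    using T unfolding polygon_triangulation_iff[OF cw] by blast+
  have ik: "1 \<le> i" "i < k" "k' \<le> N" using sub k by (auto simp: edges_on_def)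
  show "(k, k') \<in> T"
  proof (rule max)
    show "(k, k') \<in> edges_on N" using ik k by (simp add: edges_on_def)
    show "\<forall>f\<in>T. \<not> crossing (k, k') f \<and> \<not> crossing f (k, k')"
    proof
      fix f assume f: "f \<in> T"
      obtain a b where ab: "f = (a, b)" by fastforce
      have "\<not> crossing f (i, k)" "\<not> crossing (i, k) f" "\<not> crossing f (i, k')" "\<not> crossing (i, k') f"
        using nc f k by blast+
      moreover have "a = i \<Longrightarrow> \<not> (k < b \<and> b < k')" using consecutive f ab by blast
      ultimately show "\<not> crossing (k, k') f \<and> \<not> crossing f (k, k')"
        using ik k by (simp add: crossing_def ab) linarith
    qed
  qed
  show "y \<le> k'" if "(k, y) \<in> T" for y
    using nc[OF k(2) that] ik k by (auto simp: crossing_def)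
qed

text \<open>Going down from the highest corner, the neighbours of \<open>i\<close> are found from those of the higher
  corners: the neighbour after \<open>k\<close> is the last neighbour of \<open>k\<close>, so the degree of \<open>i\<close> only decides
  where to stop.\<close>

lemma triangulation_out_neighbours_subset:
  assumes cw: "clockwise N x" and T: "polygon_triangulation N x T" and U: "polygon_triangulation N x U"
    and higher: "\<And>i' b. i < i' \<Longrightarrow> (i', b) \<in> T \<longleftrightarrow> (i', b) \<in> U"
    and i: "1 \<le> i" "Suc i \<le> N"
    and y: "(i, y) \<in> T" "(i, y) \<notin> U" and w: "(i, w) \<in> U"
  shows "(i, w) \<in> T"
proof (rule ccontr)
  assume w': "(i, w) \<notin> T"
  define A where "A = {b. (i, b) \<in> T}"
  define B where "B = {b. (i, b) \<in> U}"
  define D where "D = (A - B) \<union> (B - A)"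
  have AB: "A \<subseteq> {i<..N}" "B \<subseteq> {i<..N}"
    using T U by (auto simp: polygon_triangulation_def edges_on_def A_def B_def)
  then have fin: "finite A" "finite B" by (meson finite_greaterThanAtMost finite_subset)+
  have bd: "Suc i \<in> A" "Suc i \<in> B"
    using triangulation_boundary[OF cw T i] triangulation_boundary[OF cw U i] by (auto simp: A_def B_def)
  \<comment> \<open>\<open>C\<close> collects the common neighbours before \<open>y\<close> and
    \<open>w\<close> up to which the two neighbourhoods agree. Its maximum \<open>k\<close> will be
    contradicted by a larger element.\<close>
  define C where "C = {b\<in>A \<inter> B. b < y \<and> b < w \<and> {i<..b} \<inter> D = {}}"
  have "finite C" using fin by (auto simp: C_def)
  have "y \<noteq> Suc i" "w \<noteq> Suc i" "i < y" "i < w"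
    using y w w' bd AB by (auto simp: A_def B_def)
  then have "Suc i < y" "Suc i < w" by auto
  moreover have "{i<..Suc i} = {Suc i}" by auto
  ultimately have "Suc i \<in> C" using bd by (auto simp: C_def D_def)
  define k where "k = Max C"
  have k: "k \<in> C" and k_max: "\<And>b. b \<in> C \<Longrightarrow> b \<le> k"
    using Max_in[OF \<open>finite C\<close>] Max_ge[OF \<open>finite C\<close>] \<open>Suc i \<in> C\<close> by (auto simp: k_def)
  have next_ex: "\<exists>m. (i, m) \<in> V \<and> k < m \<and> (k, m) \<in> V \<and> (\<forall>b. (k, b) \<in> V \<longrightarrow> b \<le> m) \<and>
      (\<forall>b. k < b \<and> b < m \<longrightarrow> (i, b) \<notin> V)"
    if V: "polygon_triangulation N x V" "(i, k) \<in> V" "(i, b) \<in> V" "k < b" for V b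
  proof -
    define m where "m = (LEAST m. k < m \<and> (i, m) \<in> V)"
    have m: "k < m" "(i, m) \<in> V"
      using LeastI[of "\<lambda>m. k < m \<and> (i, m) \<in> V" b] that by (auto simp: m_def)
    have cons: "(i, y) \<notin> V" if "k < y" "y < m" for y
      using not_less_Least[of y "\<lambda>m. k < m \<and> (i, m) \<in> V"] that by (auto simp: m_def)
    show ?thesis
      using m cons triangulation_consecutive[OF cw V(1,2) m(2,1) cons] by blast
  qed
  have kAB: "(i, k) \<in> T" "(i, k) \<in> U" "k < y" "k < w" "i < k"
    using k AB by (auto simp: C_def A_def B_def)
  obtain m where m: "(i, m) \<in> T" "k < m" "(k, m) \<in> T" "\<And>b. (k, b) \<in> T \<Longrightarrow> b \<le> m"
      "\<And>b. \<lbrakk>k < b; b < m\<rbrakk> \<Longrightarrow> (i, b) \<notin> T"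
    using next_ex[OF T kAB(1) y(1) kAB(3)] by blast
  obtain m' where m': "(i, m') \<in> U" "k < m'" "(k, m') \<in> U" "\<And>b. (k, b) \<in> U \<Longrightarrow> b \<le> m'"
      "\<And>b. \<lbrakk>k < b; b < m'\<rbrakk> \<Longrightarrow> (i, b) \<notin> U"
    using next_ex[OF U kAB(2) w kAB(4)] by blast
  \<comment> \<open>Both are the last neighbour of \<open>k\<close>, in \<open>T\<close> and in
    \<open>U\<close>, and at \<open>k > i\<close> the two triangulations agree.\<close>
  have "m = m'"
    using m(3,4) m'(3,4) higher[OF kAB(5)] by (meson antisym)
  \<comment> \<open>As a neighbour of \<open>i\<close> in both triangulations, \<open>m\<close>
    differs from \<open>y\<close> and from \<open>w\<close>; being the next neighbour after
    \<open>k\<close> in both, it precedes them.\<close>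
  have "m < y" using m(5)[of y] y(1,2) m'(1) \<open>m = m'\<close> kAB by (metis linorder_neqE_nat)
  moreover have "m < w" using m'(5)[of w] w w' m(1) \<open>m = m'\<close> kAB by (metis linorder_neqE_nat)
  moreover have "{i<..m} \<inter> D = {}"
  proof -
    have "b \<notin> D" if "i < b" "b \<le> m" for b
      using k m(1) m'(1) m(5)[of b] m'(5)[of b] that \<open>m = m'\<close>
      by (cases "b \<le> k"; cases "b = m") (auto simp: C_def D_def A_def B_def)
    then show ?thesis by auto
  qed
  ultimately have "m \<in> C" using m(1) m'(1) \<open>m = m'\<close> by (auto simp: C_def A_def B_def)
  then show False using k_max m(2) by fastforce
qed

text \<open>Descending induction on the corner: once all higher corners agree, the two
  out-neighbourhoods of \<open>i\<close> are nested, and equal degrees make them equal.\<close>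

lemma triangulation_unique:
  assumes cw: "clockwise (n + 2) x"
    and T: "polygon_triangulation (n + 2) x T" and U: "polygon_triangulation (n + 2) x U"
    and deg: "\<And>i. i \<in> {1..n} \<Longrightarrow> tri_outdeg T i = tri_outdeg U i"
  shows "T = U"
proof -
  have TU: "T \<subseteq> edges_on (n + 2)" "U \<subseteq> edges_on (n + 2)"
    using T U by (auto simp: polygon_triangulation_def)
  have "(i, b) \<in> T \<longleftrightarrow> (i, b) \<in> U" for i b
  proof (induction "n + 2 - i" arbitrary: i b rule: less_induct)
    case less
    have higher: "(i', b) \<in> T \<longleftrightarrow> (i', b) \<in> U" if "i < i'" for i' b
    proof (cases "i' < n + 2")
      case True
      then show ?thesis using less that by auto
    next
      case False
      then show ?thesis using TU by (auto simp: edges_on_def)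
    qed
    consider "i = 0 \<or> n + 2 \<le> i" | "i = Suc n" | "1 \<le> i" "i \<le> n" by linarith
    then show ?case
    proof cases
      case 1
      then show ?thesis using TU by (auto simp: edges_on_def)
    next
      case 2
      then show ?thesis
        using TU triangulation_boundary[OF cw T, of i] triangulation_boundary[OF cw U, of i]
        by (cases "b = Suc i") (auto simp: edges_on_def)
    next
      case 3
      define A where "A = {b. (i, b) \<in> T \<and> b \<noteq> i + 1}"
      define B where "B = {b. (i, b) \<in> U \<and> b \<noteq> i + 1}"
      have "A \<subseteq> {..n + 2}" "B \<subseteq> {..n + 2}"
        using TU by (auto simp: A_def B_def edges_on_def)
      then have fin: "finite A" "finite B" by (meson finite_atMost finite_subset)+
      have "A \<subseteq> B \<or> B \<subseteq> A"
        using triangulation_out_neighbours_subset[OF cw T U higher, of i]  3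
        unfolding A_def B_def by auto
      moreover have "card A = card B" using deg[of i] 3 by (simp add: tri_outdeg_def A_def B_def)
      ultimately have "A = B" using fin card_subset_eq by metis
      then show ?thesis
        using triangulation_boundary[OF cw T, of i] triangulation_boundary[OF cw U, of i] 3
        unfolding A_def B_def by (cases "b = Suc i") auto
    qed
  qed
  then show ?thesis by auto
qed

text \<open>The definite description in \<open>triangulation_of\<close> is justified here: the path
  of the block lengths gives existence, \<open>triangulation_unique\<close> gives
  uniqueness.\<close>

lemma triangulation_of_degrees:
  assumes cw: "clockwise (n + 2) x"
    and ballot: "\<And>m. m \<le> n \<Longrightarrow> m \<le> (\<Sum>i=1..m. card (ones_block n M i))"
    and total: "(\<Sum>i=1..n. card (ones_block n M i)) = n"
    and s: "1 \<le> s" "s \<le> n"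
  shows "tri_outdeg (triangulation_of n x M) s = card (ones_block n M s)"
proof -
  define c where "c i = card (ones_block n M i)" for i
  define H where "H m = (if m \<le> n then int (\<Sum>i=1..m. c i) - int m else - 1)" for m
  interpret ballot_path n H
  proof
    show "0 \<le> H m" if "m \<le> n" for m using ballot[OF that] that by (simp add: H_def c_def del: of_nat_sum)
    show "H m - 1 \<le> H (Suc m)" if "m \<le> n" for m
    \<comment> \<open>By \<open>total\<close> the path is at height 0 at time \<open>n\<close>, so
      the appended value -1 is a single down step.\<close>
    proof (cases "m = n")
      case True
      then show ?thesis using total by (simp add: H_def c_def)
    qed (use that in \<open>simp add: H_def\<close>)
  qed (simp_all add: H_def)
  let ?T = "path_edges n H"
  let ?P = "\<lambda>T. polygon_triangulation (n + 2) x T \<and> (\<forall>i\<in>{1..n}. tri_outdeg T i = c i)"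
  have "tri_outdeg ?T i = c i" if "i \<in> {1..n}" for i
  proof -
    obtain m where "i = Suc m" using \<open>i \<in> {1..n}\<close> by (cases i) auto
    then have "int (tri_outdeg ?T i) = int (c i)"
      using that tri_outdeg_path_edges[of i] by (simp add: H_def)
    then show ?thesis by simp
  qed
  then have "?P ?T" using path_edges_triangulation[OF cw] by blast
  moreover have "T = ?T" if "?P T" for T
    using triangulation_unique[OF cw, of T ?T] that \<open>?P ?T\<close> by simp
  ultimately have "?P (THE T. ?P T)" by (rule theI)
  then show ?thesis
    using s unfolding triangulation_of_def c_def by auto
qed

subsection \<open>Blocks of ones\<close>

definition zeros :: "nat \<Rightarrow> edge set \<Rightarrow> nat set" where
  "zeros n E = {y \<in> {1..2 * n}. outdeg E y = 0}"

text \<open>This rank replaces the list of zeros: a 1 at position \<open>y\<close> will lie in the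
  block with number \<open>Suc (count_upto Z y)\<close>.\<close>

definition count_upto :: "nat set \<Rightarrow> nat \<Rightarrow> nat" where
  "count_upto Z y = card {t \<in> Z. t \<le> y}"

lemma count_upto_mono: "finite Z \<Longrightarrow> y \<le> y' \<Longrightarrow> count_upto Z y \<le> count_upto Z y'"
  unfolding count_upto_def by (rule card_mono) auto

lemma count_upto_strict_mono:
  assumes "finite Z" "y < y'" "y' \<in> Z"
  shows "count_upto Z y < count_upto Z y'"
  unfolding count_upto_def using assms by (intro psubset_card_mono) force+

lemma count_upto_Suc: "finite Z \<Longrightarrow> count_upto Z (Suc y) = count_upto Z y + (if Suc y \<in> Z then 1 else 0)"
proof -
  assume "finite Z"
  have "{t \<in> Z. t \<le> Suc y} = {t \<in> Z. t \<le> y} \<union> (if Suc y \<in> Z then {Suc y} else {})"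
    by (auto simp: le_Suc_eq)
  then show ?thesis using \<open>finite Z\<close> by (simp add: count_upto_def)
qed

lemma count_upto_eq_iff:
  assumes "finite Z" "y \<le> y'"
  shows "count_upto Z y = count_upto Z y' \<longleftrightarrow> (\<forall>t\<in>Z. \<not> (y < t \<and> t \<le> y'))"
proof
  assume "count_upto Z y = count_upto Z y'"
  moreover have "count_upto Z y < count_upto Z y'" if "t \<in> Z" "y < t" "t \<le> y'" for t
    using count_upto_strict_mono[OF assms(1) that(2,1)] count_upto_mono[OF assms(1) that(3)] by simp
  ultimately show "\<forall>t\<in>Z. \<not> (y < t \<and> t \<le> y')" by force
next
  assume "\<forall>t\<in>Z. \<not> (y < t \<and> t \<le> y')"
  then have "{t \<in> Z. t \<le> y} = {t \<in> Z. t \<le> y'}" using assms(2) by force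
  then show "count_upto Z y = count_upto Z y'" by (simp add: count_upto_def)
qed

text \<open>In a strictly increasing list the elements up to the one with index \<open>m - 1\<close>
  are exactly the first \<open>m\<close>, as indices start at 0.\<close>

lemma sorted_list_of_set_count_upto:
  fixes Z :: "nat set"
  assumes "finite Z" "1 \<le> m" "m \<le> card Z"
  shows "sorted_list_of_set Z ! (m - 1) \<in> Z" "count_upto Z (sorted_list_of_set Z ! (m - 1)) = m"
proof -
  let ?xs = "sorted_list_of_set Z"
  have len: "m - 1 < length ?xs" using assms by simp
  show "?xs ! (m - 1) \<in> Z" using nth_mem[OF len] assms(1) by simp
  have sw: "sorted_wrt (<) ?xs" by simp
  have "{t \<in> Z. t \<le> ?xs ! (m - 1)} = (!) ?xs ` {..<m}"
  proof (intro equalityI subsetI)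
    fix t assume "t \<in> {t \<in> Z. t \<le> ?xs ! (m - 1)}"
    then have "t \<in> set ?xs" "t \<le> ?xs ! (m - 1)" using assms(1) by auto
    then obtain i where i: "i < length ?xs" "t = ?xs ! i" by (metis in_set_conv_nth)
    then have "\<not> m - 1 < i"
      using sorted_wrt_nth_less[OF sw, of "m - 1" i] \<open>t \<le> ?xs ! (m - 1)\<close> by auto
    then show "t \<in> (!) ?xs ` {..<m}" using i assms(2) by auto
  next
    fix t assume "t \<in> (!) ?xs ` {..<m}"
    then obtain i where i: "i < m" "t = ?xs ! i" by blast
    then have "t \<in> Z" using nth_mem[of i ?xs] assms len by simp
    moreover have "t \<le> ?xs ! (m - 1)"
      using sorted_wrt_nth_less[OF sw, of i "m - 1"] i len by (cases "i < m - 1") (auto simp: not_less dest: le_antisym)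
    ultimately show "t \<in> {t \<in> Z. t \<le> ?xs ! (m - 1)}" by simp
  qed
  moreover have "inj_on ((!) ?xs) {..<m}"
    using assms by (intro inj_on_nth) auto
  ultimately show "count_upto Z (?xs ! (m - 1)) = m"
    by (simp add: count_upto_def card_image)
qed

section \<open>Ballot words and the lengths of their blocks\<close>

text \<open>These properties of the outdegree word suffice to read off the degrees of the
  triangulation. Stating them for an arbitrary edge set lets both \<open>M\<close> and its flip be
  instances.\<close>

locale ballot_word =
  fixes n :: nat and E :: "edge set"
  assumes outdeg: "y \<in> {1..2 * n} \<Longrightarrow> outdeg E y = 0 \<or> outdeg E y = 1"
    and card_zeros: "card (zeros n E) = n"
    and ballot: "y \<le> 2 * n \<Longrightarrow> 2 * count_upto (zeros n E) y \<le> y"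
begin

abbreviation "Z \<equiv> zeros n E"

lemma finite_zeros: "finite Z" by (simp add: zeros_def)

lemma zeros_subset: "Z \<subseteq> {1..2 * n}" by (auto simp: zeros_def)

lemma outdeg_eq_1: "y \<in> {1..2 * n} \<Longrightarrow> outdeg E y = 1 \<longleftrightarrow> y \<notin> Z"
  using outdeg[of y] by (auto simp: zeros_def)

lemma nth_zero:
  assumes "1 \<le> m" "m \<le> n"
  shows "nth_zero n E m \<in> Z" "count_upto Z (nth_zero n E m) = m"
  using sorted_list_of_set_count_upto[OF finite_zeros assms(1)] assms(2) card_zeros
  unfolding nth_zero_def zeros_def[symmetric] by simp_all

lemma less_nth_zero_iff:
  assumes "1 \<le> m" "m \<le> n"
  shows "y < nth_zero n E m \<longleftrightarrow> count_upto Z y < m"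
  using count_upto_strict_mono[OF finite_zeros, of y "nth_zero n E m"]
    count_upto_mono[OF finite_zeros, of "nth_zero n E m" y] nth_zero[OF assms] by force

lemma nth_zero_count_upto:
  assumes "y \<in> Z"
  shows "nth_zero n E (count_upto Z y) = y"
proof -
  have "count_upto Z y \<le> card Z"
    unfolding count_upto_def using finite_zeros by (intro card_mono) auto
  moreover have "0 < count_upto Z y"
    using assms finite_zeros unfolding count_upto_def by (subst card_gt_0_iff) auto
  ultimately have r: "1 \<le> count_upto Z y" "count_upto Z y \<le> n" using card_zeros by auto
  show ?thesis
  proof (rule linorder_cases)
    assume "nth_zero n E (count_upto Z y) < y"
    then show ?thesis using count_upto_strict_mono[OF finite_zeros _ assms] nth_zero(2)[OF r] by force
  next
    assume "y < nth_zero n E (count_upto Z y)"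
    then show ?thesis using count_upto_strict_mono[OF finite_zeros _ nth_zero(1)[OF r]] nth_zero(2)[OF r] by force
  qed
qed

text \<open>A 1 lies between the zeros numbered \<open>s - 1\<close> and \<open>s\<close> exactly
  when \<open>s - 1\<close> zeros precede it; for \<open>s = 1\<close> there is no lower
  zero.\<close>

lemma ones_block_iff:
  assumes "1 \<le> s" "s \<le> n"
  shows "y \<in> ones_block n E s \<longleftrightarrow> y \<in> {1..2 * n} \<and> y \<notin> Z \<and> Suc (count_upto Z y) = s"
proof -
  have "y < nth_zero n E s \<longleftrightarrow> count_upto Z y < s" using less_nth_zero_iff[OF assms] .
  moreover have "nth_zero n E (s - 1) < y \<longleftrightarrow> s - 1 \<le> count_upto Z y" if "2 \<le> s" "y \<notin> Z"
  proof -
    have "s - 1 \<ge> 1" "s - 1 \<le> n" using that assms by auto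
    then show ?thesis
      using less_nth_zero_iff[of "s - 1" y] nth_zero(1)[of "s - 1"] \<open>y \<notin> Z\<close>
      by (metis less_asym linorder_neqE_nat not_le)
  qed
  moreover have "y \<in> ones_block n E s \<longleftrightarrow> y \<in> {1..2 * n} \<and> y \<notin> Z \<and>
      (2 \<le> s \<longrightarrow> nth_zero n E (s - 1) < y) \<and> y < nth_zero n E s"
    using outdeg_eq_1[of y] unfolding ones_block_def by blast
  ultimately show ?thesis using assms by (cases "s = 1") auto
qed

lemma sum_ones_block:
  assumes "m \<le> n"
  shows "(\<Sum>i=1..m. card (ones_block n E i)) = card {y \<in> {1..2 * n}. y \<notin> Z \<and> count_upto Z y < m}"
proof -
  have "(\<Sum>i=1..m. card (ones_block n E i)) = card (\<Union>i\<in>{1..m}. ones_block n E i)"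
  proof (rule card_UN_disjoint[symmetric])
    show "\<forall>i\<in>{1..m}. finite (ones_block n E i)" by (simp add: ones_block_def)
    show "\<forall>i\<in>{1..m}. \<forall>j\<in>{1..m}. i \<noteq> j \<longrightarrow> ones_block n E i \<inter> ones_block n E j = {}"
      using assms by (auto simp: disjoint_iff ones_block_iff)
  qed simp
  also have "(\<Union>i\<in>{1..m}. ones_block n E i) = {y \<in> {1..2 * n}. y \<notin> Z \<and> count_upto Z y < m}"
  proof (intro equalityI subsetI)
    fix y assume "y \<in> (\<Union>i\<in>{1..m}. ones_block n E i)"
    then show "y \<in> {y \<in> {1..2 * n}. y \<notin> Z \<and> count_upto Z y < m}"
      using assms by (auto simp: ones_block_iff)
  next
    fix y assume "y \<in> {y \<in> {1..2 * n}. y \<notin> Z \<and> count_upto Z y < m}"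
    then have "y \<in> ones_block n E (Suc (count_upto Z y))" "Suc (count_upto Z y) \<in> {1..m}"
      using assms by (auto simp: ones_block_iff)
    then show "y \<in> (\<Union>i\<in>{1..m}. ones_block n E i)" by blast
  qed
  finally show ?thesis .
qed

text \<open>The prefix ending at the \<open>m\<close>-th zero contains \<open>m\<close> zeros, hence
  by the ballot condition at least \<open>m\<close> ones, and all of these belong to the first
  \<open>m\<close> blocks.\<close>

lemma partial_sums_ones_block:
  assumes "m \<le> n"
  shows "m \<le> (\<Sum>i=1..m. card (ones_block n E i))"
proof (cases "m = 0")
  case False
  define y where "y = nth_zero n E m"
  have y: "y \<in> Z" "count_upto Z y = m" using nth_zero[of m] False assms by (auto simp: y_def)
  then have y': "1 \<le> y" "y \<le> 2 * n" using zeros_subset by auto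
  have "2 * m \<le> y" using ballot[OF y'(2)] y by simp
  have "{1..y} = {t \<in> {1..y}. t \<notin> Z} \<union> {t \<in> Z. t \<le> y}" using zeros_subset by auto
  moreover have "finite {t \<in> Z. t \<le> y}" using finite_zeros by simp
  ultimately have "card {1..y} = card {t \<in> {1..y}. t \<notin> Z} + count_upto Z y"
    unfolding count_upto_def by (metis (no_types, lifting) card_Un_disjoint disjoint_iff finite_Un
        finite_atLeastAtMost mem_Collect_eq)
  then have "m \<le> card {t \<in> {1..y}. t \<notin> Z}" using \<open>2 * m \<le> y\<close> y by simp
  also have "\<dots> \<le> card {t \<in> {1..2 * n}. t \<notin> Z \<and> count_upto Z t < m}"
  proof (rule card_mono)
    have "count_upto Z t < m" if "t \<le> y" "t \<notin> Z" for t
      using count_upto_strict_mono[OF finite_zeros _ y(1), of t] that y by (cases "t = y") auto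
    then show "{t \<in> {1..y}. t \<notin> Z} \<subseteq> {t \<in> {1..2 * n}. t \<notin> Z \<and> count_upto Z t < m}"
      using y' by auto
  qed simp
  also have "\<dots> = (\<Sum>i=1..m. card (ones_block n E i))" using sum_ones_block[OF assms] by simp
  finally show ?thesis .
qed simp

lemma total_ones_block: "(\<Sum>i=1..n. card (ones_block n E i)) = n"
proof (rule antisym)
  have "(\<Sum>i=1..n. card (ones_block n E i)) \<le> card ({1..2 * n} - Z)"
    unfolding sum_ones_block[OF order_refl] by (rule card_mono) auto
  also have "\<dots> = n" using zeros_subset finite_zeros card_zeros by (simp add: card_Diff_subset)
  finally show "(\<Sum>i=1..n. card (ones_block n E i)) \<le> n" .
qed (rule partial_sums_ones_block[OF order_refl])

lemma tri_outdeg_triangulation_of: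
  assumes "clockwise (n + 2) x" "1 \<le> s" "s \<le> n"
  shows "tri_outdeg (triangulation_of n x E) s = card (ones_block n E s)"
  using triangulation_of_degrees[OF assms(1) partial_sums_ones_block total_ones_block assms(2,3)] .

lemma ones_run_iff:
  assumes "s \<in> {1..2 * n}" "s \<notin> Z"
  shows "y \<in> ones_run n E s \<longleftrightarrow> s \<le> y \<and> y \<le> 2 * n \<and> count_upto Z y = count_upto Z s"
proof (cases "s \<le> y \<and> y \<le> 2 * n")
  case True
  then have "(\<forall>t\<in>{s..y}. outdeg E t = 1) \<longleftrightarrow> (\<forall>t\<in>{s..y}. t \<notin> Z)"
    using assms(1) outdeg_eq_1 by auto
  also have "\<dots> \<longleftrightarrow> (\<forall>t\<in>Z. \<not> (s < t \<and> t \<le> y))"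
    using assms(2) by (auto simp: order.order_iff_strict)
  also have "\<dots> \<longleftrightarrow> count_upto Z s = count_upto Z y" using count_upto_eq_iff[OF finite_zeros] True by simp
  finally show ?thesis using True by (auto simp: ones_run_def)
qed (auto simp: ones_run_def)

text \<open>A run is a whole block once it starts right after a zero: no 1 before \<open>s\<close>
  has the same rank.\<close>

lemma ones_block_eq_ones_run:
  assumes "Suc s \<le> 2 * n" "Suc s \<notin> Z" "s \<in> Z" "Suc (count_upto Z s) \<le> n"
  shows "ones_block n E (Suc (count_upto Z s)) = ones_run n E (Suc s)"
proof -
  have rk: "count_upto Z (Suc s) = count_upto Z s" using count_upto_Suc[OF finite_zeros, of s] assms(2) by simp
  have "y \<in> ones_block n E (Suc (count_upto Z s)) \<longleftrightarrow> y \<in> ones_run n E (Suc s)" for y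
  proof -
    have "s < y" if "y \<notin> Z" "count_upto Z y = count_upto Z s"
      using count_upto_strict_mono[OF finite_zeros _ assms(3), of y] that assms(3) by (metis less_irrefl linorder_neqE_nat)
    moreover have "y \<notin> Z" if "Suc s \<le> y" "count_upto Z y = count_upto Z s"
      using count_upto_strict_mono[OF finite_zeros, of s y] that by auto
    ultimately show ?thesis
      using assms by (auto simp: ones_block_iff ones_run_iff rk)
  qed
  then show ?thesis by auto
qed

end

subsection \<open>Perfect matchings and their flips\<close>

lemma card_eq_1I:
  assumes "\<And>b c. \<lbrakk>b \<in> S; c \<in> S\<rbrakk> \<Longrightarrow> b = c" "b \<in> S"
  shows "card S = 1"
proof -
  have "S = {b}" using assms by blast
  then show ?thesis by simp
qed

locale perfect_matching =
  fixes n :: nat and M :: "edge set"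
  assumes within: "M \<subseteq> edges_on (2 * n)"
    and cover: "y \<in> {1..2 * n} \<Longrightarrow> \<exists>!e. e \<in> M \<and> (y = fst e \<or> y = snd e)"
begin

lemma edgeD:
  assumes "(a, b) \<in> M"
  shows "1 \<le> a" "a < b" "b \<le> 2 * n"
  using assms within by (auto simp: edges_on_def)

lemma edge_unique:
  assumes "e \<in> M" "f \<in> M" "{fst e, snd e} \<inter> {fst f, snd f} \<noteq> {}"
  shows "e = f"
proof -
  have "fst e \<in> {1..2 * n}" "snd e \<in> {1..2 * n}"
    using edgeD[of "fst e" "snd e"] assms(1) by auto
  moreover have "fst e \<in> {fst f, snd f} \<or> snd e \<in> {fst f, snd f}" using assms(3) by auto
  ultimately show ?thesis using cover[of "fst e"] cover[of "snd e"] assms(1,2) by auto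
qed

lemma outdeg_start:
  assumes "(y, b) \<in> M"
  shows "outdeg M y = 1"
  unfolding outdeg_def
  by (rule card_eq_1I[of _ b]) (use assms edge_unique[of "(y, _)" "(y, _)"] in auto)

lemma outdeg_end:
  assumes "(a, y) \<in> M"
  shows "outdeg M y = 0"
proof -
  have "(y, b) \<notin> M" for b
    using edge_unique[of "(a, y)" "(y, b)"] edgeD[of a y] assms by auto
  then show ?thesis by (simp add: outdeg_def)
qed

lemma partner:
  assumes "y \<in> {1..2 * n}"
  obtains b where "(y, b) \<in> M" | a where "(a, y) \<in> M"
  using cover[OF assms] by (metis prod.collapse)

lemma zeros_eq: "zeros n M = snd ` M"
proof (intro equalityI subsetI)
  fix y assume "y \<in> zeros n M"
  then have y: "y \<in> {1..2 * n}" "outdeg M y = 0" by (auto simp: zeros_def)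
  from y(1) show "y \<in> snd ` M"
    by (cases rule: partner) (use y(2) outdeg_start in \<open>force+\<close>)
next
  fix y assume "y \<in> snd ` M"
  then obtain a where "(a, y) \<in> M" by auto
  then show "y \<in> zeros n M" using outdeg_end[of a y] edgeD[of a y] by (simp add: zeros_def)
qed

lemma inj_on_fst: "inj_on fst M" and inj_on_snd: "inj_on snd M"
  by (rule inj_onI, rule edge_unique, auto)+

lemma fst_neq_snd:
  assumes "e \<in> M" "f \<in> M"
  shows "fst e \<noteq> snd f"
proof
  assume eq: "fst e = snd f"
  then have "e = f" using edge_unique[of e f] assms by simp
  then show False using edgeD(2)[of "fst e" "snd e"] assms(1) eq by simp
qed

lemma finite_edges: "finite M"
  by (rule finite_subset[of _ "{..2 * n} \<times> {..2 * n}"]) (use edgeD in \<open>force+\<close>)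

lemma endpoints_card:
  assumes "E \<subseteq> M"
  shows "card (fst ` E \<union> snd ` E) = 2 * card E"
proof -
  have "finite E" using assms finite_edges finite_subset by blast
  moreover have "fst ` E \<inter> snd ` E = {}" using fst_neq_snd assms by blast
  moreover have "card (fst ` E) = card E" "card (snd ` E) = card E"
    using inj_on_fst inj_on_snd assms inj_on_subset card_image by metis+
  ultimately show ?thesis by (simp add: card_Un_disjoint)
qed

lemma card_zeros: "card (zeros n M) = n"
proof -
  have "fst ` M \<union> snd ` M = {1..2 * n}"
  proof (intro equalityI subsetI)
    fix y assume "y \<in> {1..2 * n}"
    then show "y \<in> fst ` M \<union> snd ` M" by (cases rule: partner) force+
  qed (use edgeD in \<open>force\<close>)
  then have "2 * card M = 2 * n" using endpoints_card[OF subset_refl] by simp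
  then show ?thesis unfolding zeros_eq using card_image[OF inj_on_snd] by simp
qed

text \<open>Each zero up to \<open>y\<close> closes an edge with both ends in \<open>{1..y}\<close>,
  and these ends are distinct. The set \<open>A\<close> holds further positions: it is empty for the
  ballot condition of \<open>M\<close>, and \<open>{i, j}\<close> for that of the flip.\<close>

lemma count_upto_bound:
  assumes "y \<le> 2 * n" "A \<subseteq> {1..y}" "\<And>e. \<lbrakk>e \<in> M; snd e \<le> y\<rbrakk> \<Longrightarrow> fst e \<notin> A \<and> snd e \<notin> A"
  shows "2 * count_upto (zeros n M) y + card A \<le> y"
proof -
  define E where "E = {e \<in> M. snd e \<le> y}"
  have E: "E \<subseteq> M" by (auto simp: E_def)
  then have fin: "finite E" using finite_edges finite_subset by blast
  have "{t \<in> zeros n M. t \<le> y} = snd ` E" by (auto simp: zeros_eq E_def)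
  then have "count_upto (zeros n M) y = card E"
    unfolding count_upto_def using card_image[of snd E] inj_on_subset[OF inj_on_snd E] by simp
  then have "2 * count_upto (zeros n M) y + card A = card (fst ` E \<union> snd ` E) + card A"
    using endpoints_card[OF E] by simp
  also have "\<dots> = card ((fst ` E \<union> snd ` E) \<union> A)"
    using fin finite_subset[OF assms(2)] assms(3) by (intro card_Un_disjoint[symmetric]) (auto simp: E_def)
  also have "\<dots> \<le> card {1..y}"
  proof (rule card_mono)
    have "1 \<le> fst e" "fst e < snd e" if "e \<in> M" for e
      using edgeD[of "fst e" "snd e"] that by auto
    then show "(fst ` E \<union> snd ` E) \<union> A \<subseteq> {1..y}"
      using assms(2) by (force simp: E_def)
  qed simp
  finally show ?thesis by simp
qed

sublocale ballot_word n M
proof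
  fix y assume "y \<in> {1..2 * n}"
  then show "outdeg M y = 0 \<or> outdeg M y = 1"
    by (cases rule: partner) (auto simp: outdeg_start outdeg_end)
next
  show "2 * count_upto (zeros n M) y \<le> y" if "y \<le> 2 * n" for y
    using count_upto_bound[of y "{}"] that by simp
qed (rule card_zeros)

end

section \<open>The effect of a flip on the word and its blocks\<close>

locale matching_flip_word = perfect_matching +
  fixes i j k l :: nat
  assumes il: "(i, l) \<in> M" and jk: "(j, k) \<in> M"
    and order: "1 \<le> i" "i < j" "j < k" "k < l" "l \<le> 2 * n"
begin

definition M' :: "edge set" where "M' = matching_flip M (i, l) (j, k)"

lemma flip_edge_iff:
  "(a, b) \<in> M' \<longleftrightarrow> (a, b) = (i, j) \<or> (a, b) = (k, l) \<or> (a, b) \<in> M \<and> (a, b) \<noteq> (i, l) \<and> (a, b) \<noteq> (j, k)"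
  by (auto simp: M'_def matching_flip_def)

text \<open>Position \<open>i\<close> still starts an edge and \<open>l\<close> still ends one; only
  \<open>j\<close> turns from start to end and \<open>k\<close> from end to start.\<close>

lemma outdeg_flip:
  "outdeg M' y = (if y = j then 0 else if y = k then 1 else outdeg M y)"
proof -
  have j: "(j, b) \<in> M \<longleftrightarrow> b = k" for b
    using edge_unique[of "(j, b)" "(j, k)"] jk by auto
  have i: "(i, b) \<in> M \<longleftrightarrow> b = l" for b
    using edge_unique[of "(i, b)" "(i, l)"] il by auto
  have k: "(k, b) \<notin> M" for b
    using fst_neq_snd[of "(k, b)" "(j, k)"] jk by auto
  have "{b. (y, b) \<in> M'} = (if y = j then {} else if y = k then {l} else if y = i then {j} else {b. (y, b) \<in> M})"
    using order by (auto simp: flip_edge_iff j i k)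
  moreover have "outdeg M i = 1" using outdeg_start[OF il] .
  ultimately show ?thesis using order by (auto simp: outdeg_def)
qed

lemma j_k_zeros: "j \<notin> Z" "k \<in> Z" "j \<in> {1..2 * n}" "k \<in> {1..2 * n}"
  using outdeg_start[OF jk] outdeg_end[OF jk] edgeD[OF jk] by (auto simp: zeros_def)

lemma zeros_flip: "zeros n M' = insert j (Z - {k})"
  using j_k_zeros order by (auto simp: zeros_def outdeg_flip)

lemma count_upto_flip:
  "count_upto (zeros n M') y = count_upto Z y + (if j \<le> y \<and> y < k then 1 else 0)"
proof -
  \<comment> \<open>\<open>S\<close> consists of the zeros up to \<open>y\<close> that both words
    share; they differ only in the zero at \<open>j\<close> and the zero at
    \<open>k\<close>.\<close>
  define S where "S = {t \<in> Z. t \<le> y} - {k}"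
  have fin: "finite {t \<in> Z. t \<le> y}" using finite_zeros by simp
  then have S: "finite S" "j \<notin> S" using j_k_zeros by (auto simp: S_def)
  have "{t \<in> zeros n M'. t \<le> y} = (if j \<le> y then insert j S else S)"
    by (auto simp: zeros_flip S_def)
  then have "count_upto (zeros n M') y = card S + (if j \<le> y then 1 else 0)"
    using S by (simp add: count_upto_def)
  moreover have "count_upto Z y = card S + (if k \<le> y then 1 else 0)"
  proof (cases "k \<le> y")
    case True
    then have "k \<in> {t \<in> Z. t \<le> y}" using j_k_zeros by simp
    then show ?thesis using card_Suc_Diff1[OF fin, of k] True by (simp add: count_upto_def S_def)
  next
    case False
    then have "S = {t \<in> Z. t \<le> y}" by (auto simp: S_def)
    then show ?thesis using False by (simp add: count_upto_def)
  qed
  ultimately show ?thesis using order by auto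
qed

text \<open>Up to a position between \<open>j\<close> and \<open>k\<close>, the ones at \<open>i\<close> and \<open>j\<close> are still unmatched in
  \<open>M\<close>, which makes up for the zero that \<open>M'\<close> has at \<open>j\<close>.\<close>

sublocale flip: ballot_word n M'
proof
  show "outdeg M' y = 0 \<or> outdeg M' y = 1" if "y \<in> {1..2 * n}" for y
    using outdeg[OF that] by (auto simp: outdeg_flip)
  have "card (Z - {k}) = n - 1" "0 < card Z"
    using j_k_zeros finite_zeros card_zeros by (auto simp: card_gt_0_iff)
  then show "card (zeros n M') = n"
    using j_k_zeros finite_zeros card_zeros by (simp add: zeros_flip)
  show "2 * count_upto (zeros n M') y \<le> y" if y: "y \<le> 2 * n" for y
  proof (cases "j \<le> y \<and> y < k")
    case True
    have "2 * count_upto Z y + card {i, j} \<le> y"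
    proof (rule count_upto_bound[OF y])
      show "{i, j} \<subseteq> {1..y}" using True order by auto
      fix e assume e: "e \<in> M" "snd e \<le> y"
      then have "e \<noteq> (i, l)" "e \<noteq> (j, k)" using True order by auto
      then show "fst e \<notin> {i, j} \<and> snd e \<notin> {i, j}"
        using edge_unique[OF e(1) il] edge_unique[OF e(1) jk] by auto
    qed
    then show ?thesis using True order by (simp add: count_upto_flip)
  next
    case False
    then show ?thesis using ballot[OF y] by (auto simp: count_upto_flip)
  qed
qed

context
  assumes j_pred: "j - 1 \<in> Z" and k_pred: "k - 1 \<in> Z" "j < k - 1"
begin

text \<open>\<open>p\<close> is the number of the block containing \<open>j\<close>, while
  \<open>k\<close> is itself the \<open>q\<close>-th zero. Since \<open>j - 1\<close> and
  \<open>k - 1\<close> are zeros, block \<open>p\<close> begins with \<open>j\<close> and block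
  \<open>q\<close> is empty.\<close>

abbreviation (input) "p \<equiv> Suc (count_upto Z j)"
abbreviation (input) "q \<equiv> count_upto Z k"

lemma count_upto_j_pred: "count_upto Z (j - 1) = count_upto Z j"
  using count_upto_Suc[OF finite_zeros, of "j - 1"] j_k_zeros order by simp

lemma count_upto_k: "q = Suc (count_upto Z (k - 1))"
  using count_upto_Suc[OF finite_zeros, of "k - 1"] j_k_zeros order by simp

lemma p_less_q: "p < q"
  using count_upto_strict_mono[OF finite_zeros k_pred(2,1)] count_upto_k by simp

text \<open>The zero at \<open>l\<close> comes after \<open>k\<close>, so a block numbered
  \<open>Suc q\<close> exists.\<close>

lemma q_less_n: "q < n"
proof -
  have "l \<in> Z" using il by (force simp: zeros_eq)
  then have "q < count_upto Z l" using count_upto_strict_mono[OF finite_zeros] order by simp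
  also have "count_upto Z l \<le> card Z"
    unfolding count_upto_def using finite_zeros by (intro card_mono) auto
  finally show ?thesis using card_zeros by simp
qed

text \<open>As \<open>j - 1\<close> is a zero, no 1 of the block of \<open>j\<close> precedes
  \<open>j\<close>, so comparison with \<open>j\<close> becomes comparison of block numbers.\<close>

lemma less_j_iff: "y \<notin> Z \<Longrightarrow> y < j \<longleftrightarrow> Suc (count_upto Z y) < p"
  using count_upto_strict_mono[OF finite_zeros _ j_pred, of y] count_upto_j_pred
    count_upto_mono[OF finite_zeros, of j y] j_pred by (cases "y = j - 1") force+

lemma less_k_iff: "y \<notin> Z \<Longrightarrow> y < k \<longleftrightarrow> Suc (count_upto Z y) < q"
  using count_upto_strict_mono[OF finite_zeros _ k_pred(1), of y] count_upto_k
    count_upto_mono[OF finite_zeros, of k y] k_pred(1) by (cases "y = k - 1") force+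

text \<open>The new zero at \<open>j\<close> raises the number of every 1 between \<open>j\<close>
  and \<open>k\<close> by one. Beyond \<open>k\<close> the lost zero compensates, and the new 1 at
  \<open>k\<close> enters block \<open>Suc q\<close>.\<close>

lemma flip_block_iff:
  assumes "1 \<le> s" "s \<le> n"
  shows "y \<in> ones_block n M' s \<longleftrightarrow> y = k \<and> s = Suc q \<or>
    y \<noteq> j \<and> y \<in> {1..2 * n} \<and> y \<notin> Z \<and>
      (if p \<le> Suc (count_upto Z y) \<and> Suc (count_upto Z y) < q then Suc (Suc (count_upto Z y)) = s
       else Suc (count_upto Z y) = s)"
proof -
  note iff = flip.ones_block_iff[OF assms, of y, unfolded count_upto_flip, unfolded zeros_flip]
  show ?thesis
  proof (cases "y = k")
    case True
    then show ?thesis using iff j_k_zeros order by auto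
  next
    case False
    then show ?thesis using iff less_j_iff[of y] less_k_iff[of y] by (cases "y \<in> Z") auto
  qed
qed

lemma block_q_empty: "ones_block n M q = {}"
proof -
  have "y \<notin> ones_block n M q" for y
    using ones_block_iff[of q y] less_k_iff[of y] count_upto_mono[OF finite_zeros, of k y]
      p_less_q q_less_n by (auto simp: not_less)
  then show ?thesis by blast
qed

text \<open>The zero at \<open>j\<close> closes an empty block \<open>p\<close>, and the old blocks
  \<open>p\<close> to \<open>q - 1\<close> move up by one. The shift ends there because the empty
  old block \<open>q\<close> disappears together with the zero at \<open>k\<close>.\<close>

lemma flip_blocks:
  shows "\<And>s. \<lbrakk>1 \<le> s; s < p\<rbrakk> \<Longrightarrow> ones_block n M' s = ones_block n M s"
    and "ones_block n M' p = {}"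
    and "ones_block n M' (Suc p) = ones_block n M p - {j}"
    and "\<And>s. \<lbrakk>p < s; s < q\<rbrakk> \<Longrightarrow> ones_block n M' (Suc s) = ones_block n M s"
    and "ones_block n M' (Suc q) = insert k (ones_block n M (Suc q))"
    and "\<And>s. \<lbrakk>Suc q < s; s \<le> n\<rbrakk> \<Longrightarrow> ones_block n M' s = ones_block n M s"
proof -
  \<comment> \<open>No 1 of the old word has block number \<open>q\<close>, so nothing collides with
    the block shifted into that place.\<close>
  have qy: "Suc (count_upto Z y) \<noteq> q" if "y \<notin> Z" for y
    using less_k_iff[OF that] count_upto_mono[OF finite_zeros, of k y] by (auto simp: not_less)
  note rules = flip_block_iff ones_block_iff
  show "ones_block n M' s = ones_block n M s" if "1 \<le> s" "s < p" for s
    using that p_less_q q_less_n by (intro set_eqI) (auto simp: rules split: if_splits)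
  show "ones_block n M' p = {}"
    using p_less_q q_less_n by (auto simp: rules split: if_splits)
  show "ones_block n M' (Suc p) = ones_block n M p - {j}"
  proof (rule set_eqI)
    fix y
    show "y \<in> ones_block n M' (Suc p) \<longleftrightarrow> y \<in> ones_block n M p - {j}"
      using p_less_q q_less_n qy[of y] by (cases "y \<in> Z") (auto simp: rules split: if_splits)
  qed
  show "ones_block n M' (Suc s) = ones_block n M s" if "p < s" "s < q" for s
  proof (rule set_eqI)
    fix y
    show "y \<in> ones_block n M' (Suc s) \<longleftrightarrow> y \<in> ones_block n M s"
      using that p_less_q q_less_n qy[of y] by (cases "y \<in> Z") (auto simp: rules split: if_splits)
  qed
  show "ones_block n M' (Suc q) = insert k (ones_block n M (Suc q))"
    using p_less_q q_less_n by (intro set_eqI) (auto simp: rules split: if_splits)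
  show "ones_block n M' s = ones_block n M s" if "Suc q < s" "s \<le> n" for s
    using that p_less_q q_less_n by (intro set_eqI) (auto simp: rules split: if_splits)
qed

end

end

subsection \<open>Flippable pairs\<close>

text \<open>A point on the line through \<open>a\<close> and \<open>b\<close> has a real parameter
  \<open>t\<close>, and its squared distance to the centre is r^2 - t(1 - t)|b - a|^2. Inside the
  disk this is below r^2, so 0 < t < 1.\<close>

lemma chord_collinear:
  assumes "a \<in> sphere z r" "b \<in> sphere z r" "a \<noteq> b" "y \<in> ball z r" "orient a b y = 0"
  shows "y \<in> open_segment a b"
proof -
  have "Im ((y - a) / (b - a)) = 0"
    using assms(5) by (simp add: orient_def complex_div_cnj[of "y - a"] mult.commute)
  then obtain t where "(y - a) / (b - a) = of_real t"
    by (metis complex_is_Real_iff Reals_cases)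
  then have y: "y = (1 - t) *\<^sub>R a + t *\<^sub>R b"
    using assms(3) by (simp add: field_simps scaleR_conv_of_real)
  have "(norm (y - z))\<^sup>2 = (1 - t) * (norm (a - z))\<^sup>2 + t * (norm (b - z))\<^sup>2 - t * (1 - t) * (norm (b - a))\<^sup>2"
    unfolding cmod_power2 y by (simp add: power2_eq_square algebra_simps)
  moreover have "norm (a - z) = r" "norm (b - z) = r"
    using assms(1,2) by (simp_all add: dist_norm norm_minus_commute)
  moreover have "(norm (y - z))\<^sup>2 < r\<^sup>2"
    using assms(4) by (intro power_strict_mono) (simp_all add: dist_norm norm_minus_commute)
  ultimately have "0 < t * (1 - t) * (norm (b - a))\<^sup>2" by (simp add: algebra_simps)
  then have "0 < t" "t < 1" by (auto simp: zero_less_mult_iff)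
  then show ?thesis using y assms(3) by (auto simp: in_segment)
qed

text \<open>A face lies on one side of every edge, and an edge between the two edges of the pair separates
  their starting points.\<close>

lemma flippable_no_edge_between:
  assumes circle: "cyclic_on_circle z r N v" and "l \<le> N" "1 \<le> i"
    and e: "(i', l') \<in> M" and ord: "i < i'" "i' < j" "j < k" "k < l'" "l' < l"
    and flip: "flippable z r v M (i, l) (j, k)"
  shows False
proof -
  define g where "g y = orient (v i') (v l') y" for y
  obtain F where F: "F \<in> components (ball z r - (\<Union>e\<in>M. seg v e))" "v i \<in> closure F" "v j \<in> closure F"
    using flip unfolding flippable_def inner_faces_def fst_conv snd_conv by blast
  have v: "v i' \<in> sphere z r" "v l' \<in> sphere z r" "v i' \<noteq> v l'"
  proof -
    have "i' \<in> {1..N}" "l' \<in> {1..N}" "i' \<noteq> l'" using ord assms(2,3) by auto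
    then show "v i' \<in> sphere z r" "v l' \<in> sphere z r" "v i' \<noteq> v l'"
      using circle unfolding cyclic_on_circle_def by (blast dest: inj_onD)+
  qed
  \<comment> \<open>A zero of \<open>g\<close> inside the disk lies on the chord, which has been
    removed from every face.\<close>
  have nz: "g y \<noteq> 0" if "y \<in> F" for y
  proof
    assume "g y = 0"
    have "y \<in> ball z r" "y \<notin> seg v (i', l')" using that in_components_subset[OF F(1)] e by auto
    then show False
      using chord_collinear[OF v] \<open>g y = 0\<close> by (simp add: g_def seg_def)
  qed
  have cont: "continuous_on S g" for S
    unfolding g_def orient_def by (intro continuous_intros)
  have "connected (g ` F)"
    using connected_continuous_image[OF cont in_components_connected[OF F(1)]] .
  then have no_change: "\<not> (g y1 < 0 \<and> 0 < g y2)" if "y1 \<in> F" "y2 \<in> F" for y1 y2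
    using connectedD_interval[of "g ` F" "g y1" "g y2" 0] nz that by auto
  have "F \<subseteq> {y. 0 \<le> g y} \<or> F \<subseteq> {y. g y \<le> 0}"
  proof (cases "\<exists>y\<in>F. g y < 0")
    case True
    then obtain y0 where "y0 \<in> F" "g y0 < 0" by blast
    then have "g y \<le> 0" if "y \<in> F" for y using no_change[OF _ that, of y0] by simp
    then show ?thesis by blast
  next
    case False
    then have "0 \<le> g y" if "y \<in> F" for y using that by (simp add: Bex_def not_less)
    then show ?thesis by blast
  qed
  \<comment> \<open>Vertices belong only to the closure of the face, so the strict sign is weakened
    to a closed half-plane before passing to them.\<close>
  moreover have "closed {y. 0 \<le> g y}" "closed {y. g y \<le> 0}"
    using cont by (auto intro!: closed_Collect_le)
  ultimately have "closure F \<subseteq> {y. 0 \<le> g y} \<or> closure F \<subseteq> {y. g y \<le> 0}"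
    using closure_minimal[of F] by blast
  then have "0 \<le> g (v i) * g (v j)"
    using F(2,3) by (auto intro: mult_nonneg_nonneg mult_nonpos_nonpos)
  moreover have "g (v i) * g (v j) < 0"
    unfolding g_def using circle ord assms(2,3)
    by (intro cyclic_orient_opposite) (auto simp: cyclic_on_circle_def)
  ultimately show False by simp
qed

theorem proposition28:
  fixes n i j k l :: nat
    and z :: complex and r :: real
    and v x :: "nat \<Rightarrow> complex"
    and M M' :: "edge set"
    and a d :: "nat \<Rightarrow> nat"
  assumes circle: "cyclic_on_circle z r (2 * n) v"
    and polygon: "clockwise (n + 2) x"
    and matching: "plane_perfect_matching n v M"
    and edges: "(i, l) \<in> M" "(j, k) \<in> M"
    and order: "1 \<le> i" "i < j" "j < k" "k < l" "l \<le> 2 * n"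
    and gaps: "j > i + 2" "k > j + 2" "l > k + 2"
    and flip: "flippable z r v M (i, l) (j, k)"
    and M': "M' = matching_flip M (i, l) (j, k)"
    and a: "a = tri_outdeg (triangulation_of n x M)"
    and d: "d = tri_outdeg (triangulation_of n x M')"
  shows "outdeg M j = 1 \<and> outdeg M (j + 1) = 1 \<and>
         outdeg M (k - 1) = 0 \<and> outdeg M k = 0 \<and> outdeg M (k + 1) = 1 \<and>
         (\<exists>!(p, q). run_indices n M j k p q) \<and>
         (\<forall>p q. run_indices n M j k p q \<longrightarrow>
            a p = card (ones_run n M j) \<and>
            a (q + 1) = card (ones_run n M (k + 1)) \<and>
            nth_zero n M (q - 1) = k - 1 \<and> nth_zero n M q = k \<and> a q = 0 \<and>
            (\<forall>s. 1 \<le> s \<and> s \<le> p - 1 \<longrightarrow> d s = a s) \<and>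
            d p = 0 \<and>
            d (p + 1) = a p - 1 \<and>
            (\<forall>s. p + 1 \<le> s \<and> s \<le> q - 1 \<longrightarrow> d (s + 1) = a s) \<and>
            d (q + 1) = a (q + 1) + 1 \<and>
            (\<forall>s. q + 2 \<le> s \<and> s \<le> n \<longrightarrow> d s = a s))"
proof -
  interpret perfect_matching n M
    using matching by unfold_locales (auto simp: plane_perfect_matching_def)
  interpret W: matching_flip_word n M i j k l
    using edges order by unfold_locales
  have M'W: "M' = W.M'" by (simp add: M' W.M'_def)
  have plane: "\<not> crossing e f" if "e \<in> M" "f \<in> M" for e f
  proof (cases "e = f")
    case False
    then have "noncrossing v e f"
      using matching that by (auto simp: plane_perfect_matching_def pairwise_def)
    then show ?thesis
      using crossing_not_noncrossing[of "2 * n" v e f] circle that within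
      by (auto simp: cyclic_on_circle_def)
  qed (simp add: crossing_def)
  \<comment> \<open>Flippability enters the proof only here; the rest uses interleaving of
    indices.\<close>
  have no_between: "\<not> (i < i' \<and> i' < j \<and> k < l' \<and> l' < l)" if "(i', l') \<in> M" for i' l'
    using flippable_no_edge_between[OF circle _ _ that _ _ _ _ _ flip] order by blast
  \<comment> \<open>An edge ending at \<open>j + 1\<close> would start before \<open>j\<close> and
    cross \<open>(j, k)\<close>; the claim for \<open>k - 1\<close> is the mirror image.\<close>
  have J1: "outdeg M (j + 1) = 1"
  proof -
    have "j + 1 \<in> {1..2 * n}" using order gaps unfolding atLeastAtMost_iff by linarith
    then show ?thesis
    proof (cases rule: partner)
      case (2 c)
      have "c \<noteq> j" using edge_unique[OF 2 edges(2)] gaps by auto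
      then have False
        using plane[OF 2 edges(2)] edgeD[OF 2] gaps unfolding crossing_def fst_conv snd_conv by presburger
      then show ?thesis ..
    qed (rule outdeg_start)
  qed
  have K1: "outdeg M (k - 1) = 0"
  proof -
    have "k - 1 \<in> {1..2 * n}" using order gaps unfolding atLeastAtMost_iff by linarith
    then show ?thesis
    proof (cases rule: partner)
      case (1 b)
      have "b \<noteq> k" using edge_unique[OF 1 edges(2)] gaps by auto
      then have False
        using plane[OF edges(2) 1] edgeD[OF 1] gaps unfolding crossing_def fst_conv snd_conv by presburger
      then show ?thesis ..
    qed (rule outdeg_end)
  qed
  \<comment> \<open>Suppose an edge from \<open>c\<close> ended at \<open>k + 1\<close>. For
    \<open>c < i\<close> it crosses \<open>(i, l)\<close>, for \<open>j < c < k\<close> it crosses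
    \<open>(j, k)\<close>, and for \<open>i < c < j\<close> it separates the pair. The claim for
    \<open>j - 1\<close> is the mirror image.\<close>
  have K2: "outdeg M (k + 1) = 1"
  proof -
    have "k + 1 \<in> {1..2 * n}" using order gaps unfolding atLeastAtMost_iff by linarith
    then show ?thesis
    proof (cases rule: partner)
      case (2 c)
      have "c \<noteq> j" "c \<noteq> i" "c \<noteq> k"
        using edge_unique[OF 2 edges(2)] edge_unique[OF 2 edges(1)] gaps by auto
      then have False
        using plane[OF edges(2) 2] plane[OF 2 edges(1)] no_between[OF 2] edgeD[OF 2] gaps
        unfolding crossing_def fst_conv snd_conv by presburger
      then show ?thesis ..
    qed (rule outdeg_start)
  qed
  have J2: "outdeg M (j - 1) = 0"
  proof -
    have "j - 1 \<in> {1..2 * n}" using order gaps unfolding atLeastAtMost_iff by linarith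
    then show ?thesis
    proof (cases rule: partner)
      case (1 b)
      have "b \<noteq> k" "b \<noteq> l" "b \<noteq> j"
        using edge_unique[OF 1 edges(2)] edge_unique[OF 1 edges(1)] gaps by auto
      then have False
        using plane[OF 1 edges(2)] plane[OF edges(1) 1] no_between[OF 1] edgeD[OF 1] gaps
        unfolding crossing_def fst_conv snd_conv by presburger
      then show ?thesis ..
    qed (rule outdeg_end)
  qed
  have Z: "j - 1 \<in> Z" "k - 1 \<in> Z" "Suc k \<notin> Z" "Suc k \<le> 2 * n" "j < k - 1"
    using J2 K1 K2 order gaps by (auto simp: zeros_def)
  note jk = W.j_k_zeros
  define P where "P = Suc (count_upto Z j)"
  define Q where "Q = count_upto Z k"
  have PQ: "1 \<le> P" "P < Q" "Suc Q \<le> n"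
    using W.p_less_q[OF Z(1,2,5)] W.q_less_n[OF Z(1,2,5)] by (simp_all add: P_def Q_def)
  have blockP: "ones_block n M P = ones_run n M j"
    using ones_block_eq_ones_run[of "j - 1"] W.count_upto_j_pred[OF Z(1,2,5)] Z jk order PQ
    by (simp add: P_def)
  have blockQ: "ones_block n M (Suc Q) = ones_run n M (Suc k)"
    using ones_block_eq_ones_run[of k] Z jk PQ by (simp add: Q_def)
  have runs: "run_indices n M j k p q \<longleftrightarrow> p = P \<and> q = Q" for p q
  proof
    \<comment> \<open>A block number is determined by any position in the block, here by
      \<open>j\<close> and \<open>Suc k\<close>, the first positions of the two runs.\<close>
    assume run: "run_indices n M j k p q"
    have "j \<in> ones_block n M p" "Suc k \<in> ones_block n M (Suc q)"
      using run ones_run_iff[of j j] ones_run_iff[of "Suc k" "Suc k"] jk Z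
      by (auto simp: run_indices_def)
    then show "p = P \<and> q = Q"
      using run ones_block_iff[of p j] ones_block_iff[of "Suc q" "Suc k"]
        count_upto_Suc[OF finite_zeros, of k] Z by (auto simp: run_indices_def P_def Q_def)
  next
    assume "p = P \<and> q = Q"
    then show "run_indices n M j k p q" using PQ blockP blockQ by (simp add: run_indices_def)
  qed
  have aB: "a s = card (ones_block n M s)" and dB: "d s = card (ones_block n M' s)"
    if "1 \<le> s" "s \<le> n" for s
    using tri_outdeg_triangulation_of[OF polygon that] W.flip.tri_outdeg_triangulation_of[OF polygon that]
    by (simp_all add: a d M'W)
  note blocks = W.flip_blocks[OF Z(1,2,5), folded P_def Q_def M'W]
  have fin: "finite (ones_block n M s)" for s by (simp add: ones_block_def)
  \<comment> \<open>These memberships make removing \<open>j\<close> and inserting \<open>k\<close>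
    change the cardinalities by exactly one.\<close>
  have "j \<in> ones_block n M P" "k \<notin> ones_block n M (Suc Q)"
    using ones_block_iff[of P j] ones_block_iff[of "Suc Q" k] jk PQ by (auto simp: P_def)
  then have "d (P + 1) = a P - 1" "d (Q + 1) = a (Q + 1) + 1"
    using PQ blocks(3,5) fin by (simp_all add: aB dB)
  moreover have "d P = 0" "a Q = 0"
    using PQ blocks(2) W.block_q_empty[OF Z(1,2,5)] by (simp_all add: aB dB Q_def[symmetric])
  moreover have "d s = a s" if "1 \<le> s" "s \<le> P - 1" for s
    using that PQ blocks(1)[of s] by (simp add: aB dB)
  moreover have "d (s + 1) = a s" if "P + 1 \<le> s" "s \<le> Q - 1" for s
    using that PQ blocks(4)[of s] by (simp add: aB dB)
  moreover have "d s = a s" if "Q + 2 \<le> s" "s \<le> n" for s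
    using that PQ blocks(6)[of s] by (simp add: aB dB)
  moreover have "a P = card (ones_run n M j)" "a (Q + 1) = card (ones_run n M (k + 1))"
    using PQ blockP blockQ by (simp_all add: aB)
  moreover have "nth_zero n M (Q - 1) = k - 1" "nth_zero n M Q = k"
    using nth_zero_count_upto[of "k - 1"] nth_zero_count_upto[of k] W.count_upto_k[OF Z(1,2,5)] Z jk
    by (simp_all add: Q_def)
  moreover have "outdeg M j = 1" "outdeg M k = 0"
    using outdeg_start[OF edges(2)] outdeg_end[OF edges(2)] by simp_all
  moreover have "\<exists>!(p, q). run_indices n M j k p q"
    by (rule ex1I[of _ "(P, Q)"]) (auto simp: runs)
  ultimately show ?thesis using J1 K1 K2 by (auto simp: runs)
qed

end
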